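(* Let $n\ge 2$ be an integer, let $\mathrm{M}$ be a matroid on $[n]=\{1,\ldots,n\}$, and let $\mathrm{Z}_{\mathrm{M}}=\mathrm{Z}_{\mathrm{M}}(q,w)$ be its homogeneous multivariate Tutte polynomial, where $w=(w_0,w_1,\ldots,w_n)$. Then for all $w\in\mathbb{R}^{n+1}_{>0}$ and all real $q$ with $0<q\le 1$, the Hessian matrix $$\mathscr{H}_{\mathrm{Z}_{\mathrm{M}}}(w)=\left(\frac{\partial^2 \mathrm{Z}_{\mathrm{M}}}{\partial w_i\,\partial w_j}\right)_{i,j=0}^n$$ has exactly one positive eigenvalue.
   Context: Let $\mathrm{rk}_{\mathrm{M}}:2^{[n]}\to\mathbb{Z}_{\ge 0}$ be the rank function of $\mathrm{M}$ (loops and parallel elements are allowed). For an integer $k\ge 0$ and a positive real parameter $q$, define $$\mathrm{Z}^k_{\mathrm{M}}=\mathrm{Z}^k_{\mathrm{M}}(q,w_1,\ldots,w_n)=\sum_{A\subseteq[n],\ |A|=k} q^{-\mathrm{rk}_{\mathrm{M}}(A)}\prod_{i\in A}w_i .$$ The homogeneous multivariate Tutte polynomial of $\mathrm{M}$ is $$\mathrm{Z}_{\mathrm{M}}=\mathrm{Z}_{\mathrm{M}}(q,w)=\sum_{k=0}^n \mathrm{Z}^{n-k}_{\mathrm{M}}\,w_0^k,$$ a homogeneous polynomial of degree $n$ in $w=(w_0,w_1,\ldots,w_n)$. Derivatives are taken with respect to $w_0,\ldots,w_n$ with $q$ fixed, and eigenvalues are counted with multiplicity. *)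

theory Defs
  imports "HOL-Analysis.Derivative" "Jordan_Normal_Form.Char_Poly"
begin

locale matroid =
  fixes E :: "'a set" and indep :: "'a set \<Rightarrow> bool"
  assumes finite_ground: "finite E"
    and indep_subset_ground: "indep X \<Longrightarrow> X \<subseteq> E"
    and indep_empty: "indep {}"
    and indep_mono: "indep X \<Longrightarrow> Y \<subseteq> X \<Longrightarrow> indep Y"
    and augment: "indep X \<Longrightarrow> indep Y \<Longrightarrow> card Y < card X \<Longrightarrow> \<exists>x\<in>X - Y. indep (insert x Y)"

definition matroid_rank :: "('a set \<Rightarrow> bool) \<Rightarrow> 'a set \<Rightarrow> nat" where
  "matroid_rank indep A = Max {card X |X. X \<subseteq> A \<and> indep X}"

definition Z_part ::
    "nat \<Rightarrow> (nat set \<Rightarrow> bool) \<Rightarrow> nat \<Rightarrow> real \<Rightarrow> (nat \<Rightarrow> real) \<Rightarrow> real" where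
  "Z_part n indep k q w =
     (\<Sum>A | A \<subseteq> {1..n} \<and> card A = k. q powi (- int (matroid_rank indep A)) * (\<Prod>i\<in>A. w i))"

definition tutte_Z ::
    "nat \<Rightarrow> (nat set \<Rightarrow> bool) \<Rightarrow> real \<Rightarrow> (nat \<Rightarrow> real) \<Rightarrow> real" where
  "tutte_Z n indep q w = (\<Sum>k=0..n. Z_part n indep (n - k) q w * w 0 ^ k)"

text \<open>
  A vector (w 0, ..., w n) is a function on \<^typ>\<open>nat\<close>; only its values at the indices 0, ..., n matter.
\<close>

definition partial_deriv ::
    "nat \<Rightarrow> ((nat \<Rightarrow> real) \<Rightarrow> real) \<Rightarrow> (nat \<Rightarrow> real) \<Rightarrow> real" where
  "partial_deriv i f w = deriv (\<lambda>t. f (w(i := t))) (w i)"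

definition hessian :: "nat \<Rightarrow> ((nat \<Rightarrow> real) \<Rightarrow> real) \<Rightarrow> (nat \<Rightarrow> real) \<Rightarrow> real mat" where
  "hessian d f w = mat d d (\<lambda>(i, j). partial_deriv i (partial_deriv j f) w)"

text \<open>
  Positive eigenvalues are counted with algebraic multiplicity. For a real symmetric matrix,
  such as a Hessian of a polynomial, this is also the geometric multiplicity, and all complex eigenvalues are real.
\<close>

definition num_pos_eigenvalues :: "real mat \<Rightarrow> nat" where
  "num_pos_eigenvalues A = (\<Sum>a | eigenvalue A a \<and> 0 < a. order a (char_poly A))"

end

theory Submission
  imports Defs "Jordan_Normal_Form.Spectral_Radius"
begin

text \<open>
  The Hessian form \<open>H\<close> of \<open>Z\<close> at \<open>w\<close> has \<open>H(w,w) > 0\<close>, so the claim is that \<open>H(x,w) = 0\<close> implies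
  \<open>H(x,x) \<le> 0\<close>. This is proved for all iterated derivatives of \<open>Z\<close> of degree \<open>d \<ge> 2\<close> by induction on \<open>d\<close>.
  For \<open>d = 2\<close> it is a Cauchy--Schwarz inequality over the parallel classes of a contraction of
  the matroid. For \<open>d > 2\<close> the hypothesis for the derivatives \<open>\<partial>\<^sub>i\<close>, with Hessians \<open>Q\<^sub>i\<close>, is the reverse
  Cauchy--Schwarz inequality \<open>Q\<^sub>i(x,x) Q\<^sub>i(w,w) \<le> Q\<^sub>i(x,w)\<^sup>2\<close>. By Euler's identity
  \<open>Q\<^sub>i w = (d - 2) H e\<^sub>i\<close> and \<open>(d - 2) H = \<Sum> w\<^sub>i Q\<^sub>i\<close>, so these inequalities sum to
  \<open>H(x,x) \<le> \<Sum> w\<^sub>i (H x)\<^sub>i\<^sup>2 / (H w)\<^sub>i\<close>. After a diagonal scaling this reads \<open>N \<le> N\<^sup>2\<close> for a nonnegative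
  matrix \<open>N\<close> with Perron eigenvalue 1, so 1, which is a simple eigenvalue, is the only positive one.
\<close>

section \<open>Diagonalization of real symmetric matrices\<close>

unbundle no vec_syntax and no inner_syntax

lemma dim_mat_diag [simp]: "dim_row (mat_diag n d) = n" "dim_col (mat_diag n d) = n"
  by (simp_all add: mat_diag_def)

text \<open>Over the complex numbers there is an eigenvector x + iy with eigenvalue a + ib. Symmetry
  gives y.Ax = x.Ay, hence b(|x|^2 + |y|^2) = 0 and b = 0. So x and y both satisfy the eigenvector
  equation for a; one of them is nonzero and can be normalized.\<close>

lemma symmetric_real_eigenvector:
  fixes A :: "real mat"
  assumes A: "A \<in> carrier_mat n n" and sym: "transpose_mat A = A" and n: "n > 0"
  shows "\<exists>v e. v \<in> carrier_vec n \<and> v \<bullet> v = 1 \<and> A *\<^sub>v v = e \<cdot>\<^sub>v v"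
proof -
  let ?C = "map_mat complex_of_real A"
  have C: "?C \<in> carrier_mat n n" using A by simp
  from spectrum_non_empty[OF C n] obtain k where "eigenvalue ?C k"
    unfolding spectrum_def by auto
  then obtain v where "eigenvector ?C v k"
    unfolding eigenvalue_def by blast
  then have v: "v \<in> carrier_vec n" "v \<noteq> 0\<^sub>v n" and ev: "?C *\<^sub>v v = k \<cdot>\<^sub>v v"
    using C A unfolding eigenvector_def by auto
  define x where "x = (\<lambda>i. Re (v $ i))"
  define y where "y = (\<lambda>i. Im (v $ i))"
  define a where "a = Re k"
  define b where "b = Im k"
  have ent: "(\<Sum>j<n. complex_of_real (A $$ (i,j)) * v $ j) = k * v $ i" if "i < n" for i
  proof -
    have "(?C *\<^sub>v v) $ i = (\<Sum>j<n. complex_of_real (A $$ (i,j)) * v $ j)"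
      using that A v by (simp add: scalar_prod_def lessThan_atLeast0)
    with ev that v show ?thesis by simp
  qed
  have hx: "(\<Sum>j<n. A $$ (i,j) * x j) = a * x i - b * y i" if "i < n" for i
    using arg_cong[OF ent[OF that], of Re] by (simp add: x_def y_def a_def b_def)
  have hy: "(\<Sum>j<n. A $$ (i,j) * y j) = a * y i + b * x i" if "i < n" for i
    using arg_cong[OF ent[OF that], of Im] by (simp add: x_def y_def a_def b_def)
  have symA: "A $$ (i,j) = A $$ (j,i)" if "i < n" "j < n" for i j
    using that A sym by (metis carrier_matD index_transpose_mat(1))
  have "(\<Sum>i<n. y i * (\<Sum>j<n. A $$ (i,j) * x j)) = (\<Sum>i<n. x i * (\<Sum>j<n. A $$ (i,j) * y j))"
    unfolding sum_distrib_left
    by (subst sum.swap, intro sum.cong refl) (auto simp: symA)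
  then have "(\<Sum>i<n. y i * (a * x i - b * y i)) = (\<Sum>i<n. x i * (a * y i + b * x i))"
    by (simp add: hx hy)
  then have "b * (\<Sum>i<n. x i * x i + y i * y i) = 0"
    by (simp add: algebra_simps sum.distrib sum_subtractf sum_distrib_left)
  moreover obtain i0 where i0: "i0 < n" "v $ i0 \<noteq> 0"
    using v by (metis eq_vecI carrier_vecD index_zero_vec)
  have "(\<Sum>i<n. x i * x i + y i * y i) > 0"
  proof (rule sum_pos2[of _ i0])
    show "0 < x i0 * x i0 + y i0 * y i0"
      using i0 by (auto simp: x_def y_def complex_eq_iff sum_squares_gt_zero_iff)
  qed (use i0 in auto)
  ultimately have b: "b = 0" by simp
  obtain z where z: "\<And>i. i < n \<Longrightarrow> (\<Sum>j<n. A $$ (i,j) * z j) = a * z i" and z0: "z i0 \<noteq> 0"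
  proof (cases "x i0 = 0")
    case True
    then have "y i0 \<noteq> 0" using i0 by (auto simp: x_def y_def complex_eq_iff)
    with hy b show ?thesis by (intro that[of y]) auto
  next
    case False
    with hx b show ?thesis by (intro that[of x]) auto
  qed
  define r where "r = sqrt (\<Sum>i<n. z i * z i)"
  have "(\<Sum>i<n. z i * z i) > 0"
    by (rule sum_pos2[of _ i0]) (use i0 z0 in \<open>auto simp: zero_less_mult_iff\<close>)
  then have r: "r > 0" "r * r = (\<Sum>i<n. z i * z i)" by (auto simp: r_def)
  let ?u = "vec n (\<lambda>i. z i / r)"
  have "?u \<bullet> ?u = (\<Sum>i<n. z i * z i) / (r * r)"
    by (simp add: scalar_prod_def lessThan_atLeast0 sum_divide_distrib)
  then have "?u \<bullet> ?u = 1" using r(1) by (simp flip: r(2))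
  moreover have "A *\<^sub>v ?u = a \<cdot>\<^sub>v ?u"
  proof (rule eq_vecI)
    fix i assume "i < dim_vec (a \<cdot>\<^sub>v ?u)"
    then have i: "i < n" by simp
    have "(A *\<^sub>v ?u) $ i = (\<Sum>j<n. A $$ (i,j) * z j) / r"
      using i A by (simp add: scalar_prod_def lessThan_atLeast0 sum_divide_distrib)
    then show "(A *\<^sub>v ?u) $ i = (a \<cdot>\<^sub>v ?u) $ i" using z[OF i] i by simp
  qed (use A in auto)
  ultimately show ?thesis by (intro exI[of _ ?u] exI[of _ a]) auto
qed

text \<open>The Householder reflection 1 - c uu^T with u = v - e_0 maps e_0 to \<open>v\<close>
  because \<open>v\<close> has norm 1.\<close>

lemma householder_reflection:
  fixes v :: "real vec"
  assumes v: "v \<in> carrier_vec (Suc n)" and norm: "v \<bullet> v = 1"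
  shows "\<exists>W \<in> carrier_mat (Suc n) (Suc n). transpose_mat W = W \<and> W * W = 1\<^sub>m (Suc n) \<and> col W 0 = v"
proof -
  define \<delta> where "\<delta> = (\<lambda>i j::nat. if i = j then 1 else 0 :: real)"
  define u where "u = (\<lambda>i. v $ i - \<delta> i 0)"
  define N where "N = (\<Sum>i<Suc n. u i * u i)"
  \<comment> \<open>If v = e_0, then \<open>N = 0\<close> and \<open>c = 2 / 0 = 0\<close>, so the
    reflection degenerates to the identity, as required.\<close>
  define c where "c = 2 / N"
  have \<delta>l: "(\<Sum>k<Suc n. \<delta> i k * f k) = f i" "(\<Sum>k<Suc n. \<delta> k i * f k) = f i" if "i < Suc n" for i and f :: "nat \<Rightarrow> real"
    using that by (simp_all add: \<delta>_def if_distrib[of "\<lambda>x. x * _"] cong: if_cong)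
  have vv: "(\<Sum>i<Suc n. v $ i * v $ i) = 1"
    using norm v by (simp add: scalar_prod_def lessThan_atLeast0)
  have "N = (\<Sum>i<Suc n. v $ i * v $ i - 2 * (\<delta> i 0 * v $ i) + \<delta> i 0 * \<delta> i 0)"
    unfolding N_def u_def by (intro sum.cong) (auto simp: algebra_simps)
  also have "\<dots> = 2 - 2 * v $ 0"
    unfolding sum.distrib sum_subtractf vv sum_distrib_left[symmetric]
    by (subst \<delta>l, simp, subst \<delta>l, simp) (simp add: \<delta>_def)
  finally have N: "N = 2 - 2 * v $ 0" .
  have cN: "c * c * N = 2 * c" by (simp add: c_def)
  have cu: "c * u i * u 0 = - u i" if i: "i < Suc n" for i
  proof (cases "N = 0")
    case True
    then have "\<forall>i\<in>{..<Suc n}. u i * u i = 0" unfolding N_def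
      by (subst (asm) sum_nonneg_eq_0_iff) auto
    with i show ?thesis by auto
  next
    case False
    then have "c * u 0 = -1" using N by (simp add: c_def u_def \<delta>_def field_simps)
    then show ?thesis by (metis mult.assoc mult.commute mult_minus1)
  qed
  let ?W = "mat (Suc n) (Suc n) (\<lambda>(i,j). \<delta> i j - c * u i * u j)"
  have "transpose_mat ?W = ?W" by (rule eq_matI) (auto simp: \<delta>_def)
  moreover have "?W * ?W = 1\<^sub>m (Suc n)"
  proof (rule eq_matI)
    fix i j assume "i < dim_row (1\<^sub>m (Suc n) :: real mat)" "j < dim_col (1\<^sub>m (Suc n) :: real mat)"
    then have i: "i < Suc n" and j: "j < Suc n" by auto
    have "(?W * ?W) $$ (i,j) = (\<Sum>k<Suc n. (\<delta> i k - c * u i * u k) * (\<delta> k j - c * u k * u j))"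
      using i j by (simp add: scalar_prod_def lessThan_atLeast0)
    also have "\<dots> = (\<Sum>k<Suc n. \<delta> i k * \<delta> k j - c * u j * (\<delta> i k * u k) - c * u i * (\<delta> k j * u k)
        + c * c * u i * u j * (u k * u k))"
      by (intro sum.cong) (auto simp: algebra_simps)
    also have "\<dots> = \<delta> i j - c * u j * u i - c * u i * u j + c * c * u i * u j * N"
      unfolding sum.distrib sum_subtractf sum_distrib_left[symmetric] \<delta>l[OF i] \<delta>l[OF j] N_def ..
    also have "c * c * u i * u j * N = 2 * c * u i * u j" using cN by (metis mult.assoc mult.commute)
    finally show "(?W * ?W) $$ (i,j) = 1\<^sub>m (Suc n) $$ (i,j)"
      using i j by (simp add: \<delta>_def)
  qed auto
  moreover have "col ?W 0 = v"
  proof (rule eq_vecI)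
    fix i assume "i < dim_vec v"
    then have i: "i < Suc n" using v by simp
    then show "col ?W 0 $ i = v $ i" using cu[OF i] by (simp add: u_def)
  qed (use v in auto)
  ultimately show ?thesis by (intro bexI[of _ ?W]) auto
qed

text \<open>Deflation: conjugation with a reflection whose first column is a unit eigenvector turns
  the first column of the matrix into a multiple of e_0. By symmetry the first row has the same
  form, so \<open>B\<close> is block diagonal and the induction hypothesis applies to the lower
  block.\<close>

lemma symmetric_real_diagonalization:
  fixes A :: "real mat"
  assumes "A \<in> carrier_mat n n" and "transpose_mat A = A"
  shows "\<exists>P d. P \<in> carrier_mat n n \<and> P * transpose_mat P = 1\<^sub>m n \<and> A = P * mat_diag n d * transpose_mat P"
  using assms
proof (induction n arbitrary: A)
  case 0
  then show ?case by (intro exI[of _ A] exI[of _ undefined]) (auto intro!: eq_matI)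
next
  case (Suc n)
  note A = Suc.prems(1)
  from symmetric_real_eigenvector[OF Suc.prems] obtain v e where
    v: "v \<in> carrier_vec (Suc n)" "v \<bullet> v = 1" and ev: "A *\<^sub>v v = e \<cdot>\<^sub>v v" by auto
  from householder_reflection[OF v] obtain W where W: "W \<in> carrier_mat (Suc n) (Suc n)"
    and tW: "transpose_mat W = W" and WW: "W * W = 1\<^sub>m (Suc n)" and W0: "col W 0 = v" by auto
  define B where "B = W * A * W"
  have B: "B \<in> carrier_mat (Suc n) (Suc n)" using A W by (simp add: B_def)
  have tB: "transpose_mat B = B"
    unfolding B_def using A W tW Suc.prems(2)
    by (simp add: transpose_mult[of _ "Suc n" "Suc n" _ "Suc n"] assoc_mult_mat[of _ "Suc n" "Suc n" _ "Suc n" _ "Suc n"])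
  have WBW: "A = W * B * W"
  proof -
    have "W * B * W = (W * W) * A * (W * W)"
      unfolding B_def using A W by (simp add: assoc_mult_mat[of _ "Suc n" "Suc n" _ "Suc n" _ "Suc n"])
    then show ?thesis using A WW by simp
  qed
  have c0: "col B 0 = e \<cdot>\<^sub>v unit_vec (Suc n) 0"
  proof -
    have "col B 0 = (W * A) *\<^sub>v v"
      unfolding B_def using A W W0 by (subst col_mult2[of _ "Suc n" "Suc n" _ "Suc n"]) auto
    also have "\<dots> = W *\<^sub>v (e \<cdot>\<^sub>v v)"
      using A W v ev by (subst assoc_mult_mat_vec[of _ "Suc n" "Suc n" _ "Suc n"]) auto
    also have "\<dots> = e \<cdot>\<^sub>v (W *\<^sub>v v)" using W v by (simp add: mult_mat_vec)
    also have "W *\<^sub>v v = col (W * W) 0" using W W0 by (subst col_mult2[of _ "Suc n" "Suc n" _ "Suc n"]) auto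
    also have "\<dots> = unit_vec (Suc n) 0" using WW by simp
    finally show ?thesis .
  qed
  have Bi0: "B $$ (i,0) = (if i = 0 then e else 0)" if "i < Suc n" for i
    using arg_cong[OF c0, of "\<lambda>x. x $ i"] that B by auto
  have symB: "B $$ (i,j) = B $$ (j,i)" if "i < Suc n" "j < Suc n" for i j
    using that B tB by (metis carrier_matD index_transpose_mat(1))
  define A' where "A' = mat n n (\<lambda>(i,j). B $$ (Suc i, Suc j))"
  have A': "A' \<in> carrier_mat n n" "transpose_mat A' = A'"
    by (auto simp: A'_def symB)
  from Suc.IH[OF A'] obtain P' d where P': "P' \<in> carrier_mat n n" "P' * transpose_mat P' = 1\<^sub>m n"
    and A'd: "A' = P' * mat_diag n d * transpose_mat P'" by auto
  let ?Q = "four_block_mat (1\<^sub>m 1) (0\<^sub>m 1 n) (0\<^sub>m n 1) P'"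
  let ?D = "four_block_mat (mat_diag 1 (\<lambda>_. e)) (0\<^sub>m 1 n) (0\<^sub>m n 1) (mat_diag n d)"
  have Q: "?Q \<in> carrier_mat (Suc n) (Suc n)" using P' by auto
  have tQ: "transpose_mat ?Q = four_block_mat (1\<^sub>m 1) (0\<^sub>m 1 n) (0\<^sub>m n 1) (transpose_mat P')"
    using P' by (subst transpose_four_block_mat) auto
  have QQ: "?Q * transpose_mat ?Q = 1\<^sub>m (Suc n)"
    unfolding tQ using P' by (subst mult_four_block_mat[of _ 1 1 _ n _ n _ _ 1 _ n]) (auto intro!: eq_matI)
  have D: "?D = mat_diag (Suc n) (case_nat e d)"
    by (rule eq_matI) (auto simp: mat_diag_def split: nat.splits)
  have M: "P' * mat_diag n d * transpose_mat P' \<in> carrier_mat n n"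
    using P' by (intro mult_carrier_mat[of _ n n]) auto
  have "?Q * ?D * transpose_mat ?Q = four_block_mat (mat_diag 1 (\<lambda>_. e)) (0\<^sub>m 1 n) (0\<^sub>m n 1) A'"
    unfolding tQ A'd using P'
    by (subst mult_four_block_mat[of _ 1 1 _ n _ n _ _ 1 _ n], simp_all add: left_mult_zero_mat[of _ n n],
        subst mult_four_block_mat[of _ 1 1 _ n _ n _ _ 1 _ n],
        simp_all add: left_mult_zero_mat[of _ n n] left_mult_zero_mat[of _ 1 n] left_add_zero_mat[OF M])
  also have "\<dots> = B"
    by (rule eq_matI, insert B Bi0 symB[of 0], auto simp: A'_def mat_diag_def)
  finally have Bd: "B = ?Q * mat_diag (Suc n) (case_nat e d) * transpose_mat ?Q" unfolding D ..
  let ?P = "W * ?Q"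
  have tP: "transpose_mat ?P = transpose_mat ?Q * W" using transpose_mult[OF W Q] tW by simp
  have tQc: "transpose_mat ?Q \<in> carrier_mat (Suc n) (Suc n)" using Q by (simp only: transpose_carrier_mat)
  have Dc: "mat_diag (Suc n) (case_nat e d) \<in> carrier_mat (Suc n) (Suc n)" by simp
  have assoc: "X * Y * Z = X * (Y * Z)" if "X \<in> carrier_mat (Suc n) (Suc n)" "Y \<in> carrier_mat (Suc n) (Suc n)"
    "Z \<in> carrier_mat (Suc n) (Suc n)" for X Y Z :: "real mat"
    using that by (rule assoc_mult_mat)
  have "?P * transpose_mat ?P = W * (?Q * transpose_mat ?Q) * W"
    unfolding tP using W Q tQc by (simp only: assoc mult_carrier_mat)
  then have "?P * transpose_mat ?P = 1\<^sub>m (Suc n)" using QQ W WW by simp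
  moreover have "A = ?P * mat_diag (Suc n) (case_nat e d) * transpose_mat ?P"
    unfolding tP WBW Bd using W Q tQc Dc by (simp only: assoc mult_carrier_mat)
  ultimately show ?case using W Q by (intro exI[of _ ?P] exI[of _ "case_nat e d"]) auto
qed

text \<open>\<open>p k\<close> is column \<open>k\<close> of the orthogonal matrix, that is, the
  k-th eigenvector. The factored characteristic polynomial is kept because it records
  multiplicities.\<close>

lemma symmetric_real_eigenbasis:
  fixes A :: "nat \<Rightarrow> nat \<Rightarrow> real"
  assumes sym: "\<And>i j. i < n \<Longrightarrow> j < n \<Longrightarrow> A i j = A j i"
  obtains p :: "nat \<Rightarrow> nat \<Rightarrow> real" and d :: "nat \<Rightarrow> real"
  where "\<And>k l. k < n \<Longrightarrow> l < n \<Longrightarrow> (\<Sum>i<n. p k i * p l i) = (if k = l then 1 else 0)"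
    and "\<And>i j. i < n \<Longrightarrow> j < n \<Longrightarrow> A i j = (\<Sum>k<n. d k * p k i * p k j)"
    and "char_poly (mat n n (\<lambda>(i,j). A i j)) = (\<Prod>k<n. [:- d k, 1:])"
proof -
  let ?A = "mat n n (\<lambda>(i,j). A i j)"
  have "transpose_mat ?A = ?A" by (rule eq_matI) (auto simp: sym)
  with symmetric_real_diagonalization[of ?A n] obtain P d where P: "P \<in> carrier_mat n n"
    and PP: "P * transpose_mat P = 1\<^sub>m n" and Ad: "?A = P * mat_diag n d * transpose_mat P" by auto
  have tP: "transpose_mat P \<in> carrier_mat n n" using P by simp
  have PP': "transpose_mat P * P = 1\<^sub>m n" by (rule mat_mult_left_right_inverse[OF P tP PP])
  show ?thesis
  proof
    show "(\<Sum>i<n. P $$ (i,k) * P $$ (i,l)) = (if k = l then 1 else 0)" if "k < n" "l < n" for k l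
      using arg_cong[OF PP', of "\<lambda>M. M $$ (k,l)"] that P by (simp add: scalar_prod_def lessThan_atLeast0)
    have PD: "(P * mat_diag n d) $$ (i,k) = d k * P $$ (i,k)" if "i < n" "k < n" for i k
      using that P by (simp add: mat_diag_mult_right)
    show "A i j = (\<Sum>k<n. d k * P $$ (i,k) * P $$ (j,k))" if "i < n" "j < n" for i j
    proof -
      have "A i j = (P * mat_diag n d * transpose_mat P) $$ (i,j)" using that by (simp flip: Ad)
      also have "\<dots> = (\<Sum>k<n. (P * mat_diag n d) $$ (i,k) * P $$ (j,k))"
        using that P by (simp add: scalar_prod_def lessThan_atLeast0 del: mat_diag_mult_right)
      finally show ?thesis using that PD by simp
    qed
    have "similar_mat ?A (mat_diag n d)"
      by (rule similar_matI[OF _ PP PP' Ad]) (use P in auto)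
    then have "char_poly ?A = char_poly (mat_diag n d)" by (rule char_poly_similar)
    also have "\<dots> = (\<Prod>a\<leftarrow>diag_mat (mat_diag n d). [:- a, 1:])"
      by (rule char_poly_upper_triangular[of _ n]) (auto simp: mat_diag_def)
    also have "diag_mat (mat_diag n d) = map d [0..<n]"
      by (simp add: diag_mat_def mat_diag_def)
    finally show "char_poly ?A = (\<Prod>k<n. [:- d k, 1:])"
      using prod.distinct_set_conv_list[of "[0..<n]" "\<lambda>k. [:- d k, 1:]"]
      by (simp add: o_def lessThan_atLeast0)
  qed
qed

section \<open>Forms that are negative on a hyperplane\<close>

definition bilin :: "nat \<Rightarrow> (nat \<Rightarrow> nat \<Rightarrow> real) \<Rightarrow> (nat \<Rightarrow> real) \<Rightarrow> (nat \<Rightarrow> real) \<Rightarrow> real" where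
  "bilin n H x y = (\<Sum>i<n. \<Sum>j<n. H i j * x i * y j)"

lemma bilin_commute:
  assumes "\<And>i j. i < n \<Longrightarrow> j < n \<Longrightarrow> H i j = H j i"
  shows "bilin n H x y = bilin n H y x"
  unfolding bilin_def by (subst sum.swap, intro sum.cong refl) (simp add: assms mult_ac)

lemma bilin_linear_left:
  "bilin n H (\<lambda>i. \<alpha> * x i + \<beta> * y i) z = \<alpha> * bilin n H x z + \<beta> * bilin n H y z"
  unfolding bilin_def sum_distrib_left sum.distrib[symmetric]
  by (intro sum.cong refl) (simp add: algebra_simps)

lemma bilin_linear_right:
  "bilin n H z (\<lambda>i. \<alpha> * x i + \<beta> * y i) = \<alpha> * bilin n H z x + \<beta> * bilin n H z y"
  unfolding bilin_def sum_distrib_left sum.distrib[symmetric]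
  by (intro sum.cong refl) (simp add: algebra_simps)

lemma bilin_eq_sum_left: "bilin n H x y = (\<Sum>i<n. x i * (\<Sum>j<n. H i j * y j))"
  unfolding bilin_def sum_distrib_left by (intro sum.cong refl) (simp add: algebra_simps)

lemma bilin_eigen_expansion:
  assumes "\<And>i j. i < n \<Longrightarrow> j < n \<Longrightarrow> H i j = (\<Sum>k<n. d k * p k i * p k j)"
  shows "bilin n H x y = (\<Sum>k<n. d k * (\<Sum>i<n. p k i * x i) * (\<Sum>j<n. p k j * y j))"
proof -
  have "bilin n H x y = (\<Sum>i<n. \<Sum>j<n. \<Sum>k<n. d k * (p k i * x i) * (p k j * y j))"
    unfolding bilin_def by (intro sum.cong refl) (simp add: assms sum_distrib_left sum_distrib_right mult_ac)
  also have "\<dots> = (\<Sum>i<n. \<Sum>k<n. \<Sum>j<n. d k * (p k i * x i) * (p k j * y j))"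
    by (intro sum.cong refl sum.swap)
  also have "\<dots> = (\<Sum>k<n. \<Sum>i<n. \<Sum>j<n. d k * (p k i * x i) * (p k j * y j))"
    by (rule sum.swap)
  also have "\<dots> = (\<Sum>k<n. d k * (\<Sum>i<n. p k i * x i) * (\<Sum>j<n. p k j * y j))"
    by (intro sum.cong refl) (simp add: sum_distrib_left sum_distrib_right mult_ac)
  finally show ?thesis .
qed

text \<open>\<open>x\<close> and \<open>y\<close> would span a plane on which the form is positive
  definite, but this plane contains a nonzero vector of the kernel of H(.,v), where the form is at
  most 0.\<close>

lemma no_orthogonal_positive_pair:
  assumes sym: "\<And>i j. i < n \<Longrightarrow> j < n \<Longrightarrow> H i j = H j i"
    and neg: "\<And>x. bilin n H x v = 0 \<Longrightarrow> bilin n H x x \<le> 0"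
    and orth: "bilin n H x y = 0" and x: "bilin n H x x > 0" and y: "bilin n H y y > 0"
  shows False
proof (cases "bilin n H x v = 0")
  case True
  with neg[of x] x show False by simp
next
  case False
  define \<alpha> \<beta> where "\<alpha> = bilin n H y v" and "\<beta> = - bilin n H x v"
  let ?z = "\<lambda>i. \<alpha> * x i + \<beta> * y i"
  have "bilin n H ?z v = 0" unfolding bilin_linear_left by (simp add: \<alpha>_def \<beta>_def)
  then have "bilin n H ?z ?z \<le> 0" by (rule neg)
  moreover have "bilin n H y x = bilin n H x y" by (rule bilin_commute[OF sym])
  then have "bilin n H ?z ?z = \<alpha>\<^sup>2 * bilin n H x x + \<beta>\<^sup>2 * bilin n H y y"
    using orth by (simp add: bilin_linear_left bilin_linear_right power2_eq_square)
  moreover have "\<beta>\<^sup>2 * bilin n H y y > 0" using False y by (simp add: \<beta>_def)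
  moreover have "\<alpha>\<^sup>2 * bilin n H x x \<ge> 0" using x by simp
  ultimately show False by linarith
qed

text \<open>Subtracting from \<open>x\<close> its component along \<open>a\<close> gives a vector in
  the kernel of H(.,a), to which \<open>neg\<close> applies.\<close>

lemma negative_on_complement_imp_cauchy_schwarz:
  assumes sym: "\<And>i j. i < n \<Longrightarrow> j < n \<Longrightarrow> H i j = H j i"
    and neg: "\<And>x. bilin n H x a = 0 \<Longrightarrow> bilin n H x x \<le> 0"
    and pos: "bilin n H a a > 0"
  shows "bilin n H x x * bilin n H a a \<le> (bilin n H x a)\<^sup>2"
proof -
  let ?c = "bilin n H x a / bilin n H a a"
  let ?z = "\<lambda>i. 1 * x i + (- ?c) * a i"
  have "bilin n H ?z a = 0"
    using pos unfolding bilin_linear_left by simp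
  then have "bilin n H ?z ?z \<le> 0" by (rule neg)
  moreover have "bilin n H a x = bilin n H x a" by (rule bilin_commute[OF sym])
  ultimately have "bilin n H x x - (bilin n H x a)\<^sup>2 / bilin n H a a \<le> 0"
    using pos unfolding bilin_linear_left bilin_linear_right by (simp add: power2_eq_square)
  then show ?thesis using pos by (simp add: field_simps)
qed

text \<open>
  With \<open>D = diag ((H a) i / a i)\<close> and \<open>N = D\<^sup>-\<^sup>1\<^sup>/\<^sup>2 H D\<^sup>-\<^sup>1\<^sup>/\<^sup>2\<close> the hypothesis \<open>bound\<close> says \<open>N \<le> N\<^sup>2\<close>, so each
  positive eigenvalue of \<open>N\<close> is at least 1. As in the Perron--Frobenius theorem, an eigenvector
  for such an eigenvalue is a multiple of \<open>D\<^sup>1\<^sup>/\<^sup>2 a\<close>. Zero rows of \<open>H\<close> are harmless since \<open>x / 0 = 0\<close>.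
\<close>

lemma negative_on_complement_of_positive_vector:
  assumes sym: "\<And>i j. i < n \<Longrightarrow> j < n \<Longrightarrow> H i j = H j i"
    and nonneg: "\<And>i j. i < n \<Longrightarrow> j < n \<Longrightarrow> H i j \<ge> 0"
    and hub: "\<And>i j. i < n \<Longrightarrow> j < n \<Longrightarrow> H i j > 0 \<Longrightarrow> H i 0 > 0"
    and a: "\<And>i. i < n \<Longrightarrow> a i > 0"
    and bound: "\<And>x. bilin n H x x \<le> (\<Sum>i<n. a i * (\<Sum>j<n. H i j * x j)\<^sup>2 / (\<Sum>j<n. H i j * a j))"
    and orth: "bilin n H x a = 0"
  shows "bilin n H x x \<le> 0"
proof -
  define D where "D = (\<lambda>i. (\<Sum>j<n. H i j * a j) / a i)"
  define s where "s = (\<lambda>i. sqrt (D i))"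
  define N where "N = (\<lambda>i j. H i j / (s i * s j))"
  have Da: "(\<Sum>j<n. H i j * a j) = D i * a i" if "i < n" for i
    using a[OF that] by (simp add: D_def)
  have D0: "D i \<ge> 0" if "i < n" for i
    unfolding D_def using that
    by (auto intro!: divide_nonneg_pos sum_nonneg mult_nonneg_nonneg[OF nonneg less_imp_le[OF a]] a)
  have ss: "s i * s i = D i" if "i < n" for i using D0[OF that] by (simp add: s_def)
  \<comment> \<open>\<open>D i = 0\<close> forces row \<open>i\<close> of \<open>H\<close> to
    vanish, as its entries are nonnegative and \<open>a\<close> is positive. Hence \<open>H\<close>
    is recovered from \<open>N\<close> even at indices where \<open>N\<close> is defined by a
    division by 0.\<close>
  have dead: "H i j = 0" if "s i = 0" "i < n" "j < n" for i j
  proof -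
    have "(\<Sum>j<n. H i j * a j) = 0" using Da[OF that(2)] ss[OF that(2)] that(1) by simp
    then have "\<forall>j\<in>{..<n}. H i j * a j = 0"
      using that(2) by (subst (asm) sum_nonneg_eq_0_iff) (auto intro!: mult_nonneg_nonneg[OF nonneg less_imp_le[OF a]])
    then show ?thesis using that a[of j] by auto
  qed
  have HN: "H i j = s i * N i j * s j" if "i < n" "j < n" for i j
  proof (cases "s i = 0 \<or> s j = 0")
    case True
    then have "H i j = 0" using dead[of i j] dead[of j i] sym[OF that] that by metis
    then show ?thesis by (simp add: N_def)
  qed (simp add: N_def)
  have "N i j = N j i" if "i < n" "j < n" for i j unfolding N_def by (simp only: sym[OF that] mult.commute)
  then obtain p d where
    on: "\<And>k l. k < n \<Longrightarrow> l < n \<Longrightarrow> (\<Sum>i<n. p k i * p l i) = (if k = l then 1 else 0)"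
    and Nd: "\<And>i j. i < n \<Longrightarrow> j < n \<Longrightarrow> N i j = (\<Sum>k<n. d k * p k i * p k j)"
    by (rule symmetric_real_eigenbasis[of n N]) blast+
  have Np: "(\<Sum>j<n. N i j * p k j) = d k * p k i" if i: "i < n" and k: "k < n" for i k
  proof -
    have "(\<Sum>j<n. N i j * p k j) = (\<Sum>j<n. \<Sum>l<n. d l * p l i * (p l j * p k j))"
      using i by (intro sum.cong refl) (simp add: Nd sum_distrib_left sum_distrib_right mult_ac)
    also have "\<dots> = (\<Sum>l<n. \<Sum>j<n. d l * p l i * (p l j * p k j))" by (rule sum.swap)
    also have "\<dots> = (\<Sum>l<n. d l * p l i * (if l = k then 1 else 0))"
      using k by (intro sum.cong refl) (simp add: sum_distrib_left[symmetric] on)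
    finally show ?thesis using k by (simp add: if_distrib cong: if_cong)
  qed
  have parallel: "\<exists>c. \<forall>i<n. p k i = c * (s i * a i)" if k: "k < n" and dk: "d k > 0" for k
  proof -
    \<comment> \<open>Undoing the scaling: \<open>z\<close> solves H z = \<open>d k\<close> D z.
      Where \<open>s i = 0\<close>, row \<open>i\<close> of \<open>N\<close> vanishes, so
      \<open>d k > 0\<close> forces \<open>p k i = 0\<close> and nothing is lost.\<close>
    define z where "z = (\<lambda>i. p k i / s i)"
    have pk: "p k i = s i * z i" if i: "i < n" for i
    proof (cases "s i = 0")
      case True
      then have "d k * p k i = 0" using Np[OF i k] by (simp add: N_def)
      with dk True show ?thesis by simp
    qed (simp add: z_def)
    have norm: "(\<Sum>i<n. D i * z i * z i) = 1"
    proof -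
      have "(\<Sum>i<n. D i * z i * z i) = (\<Sum>i<n. p k i * p k i)"
        by (intro sum.cong refl) (simp add: pk flip: ss)
      then show ?thesis using on[OF k k] by simp
    qed
    have Hz: "(\<Sum>j<n. H i j * z j) = d k * D i * z i" if i: "i < n" for i
    proof -
      have "(\<Sum>j<n. H i j * z j) = s i * (\<Sum>j<n. N i j * p k j)"
        unfolding sum_distrib_left using i by (intro sum.cong refl) (simp add: HN pk)
      also have "\<dots> = d k * D i * z i" unfolding Np[OF i k] pk[OF i] ss[OF i, symmetric] by simp
      finally show ?thesis .
    qed
    have zz: "bilin n H z z = d k"
    proof -
      have "bilin n H z z = (\<Sum>i<n. d k * (D i * z i * z i))"
        unfolding bilin_eq_sum_left by (intro sum.cong refl) (simp add: Hz)
      then show ?thesis by (simp add: norm flip: sum_distrib_left)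
    qed
    \<comment> \<open>This is \<open>bound\<close> at \<open>z\<close>; by the normalization of
      \<open>z\<close> the right side is the square of \<open>d k\<close>.\<close>
    have "d k \<le> (\<Sum>i<n. (d k)\<^sup>2 * (D i * z i * z i))"
    proof -
      have "a i * (\<Sum>j<n. H i j * z j)\<^sup>2 / (\<Sum>j<n. H i j * a j) = (d k)\<^sup>2 * (D i * z i * z i)" if "i < n" for i
        using a[OF that] by (cases "D i = 0") (auto simp: Hz[OF that] Da[OF that] power2_eq_square)
      with bound[of z] zz show ?thesis by simp
    qed
    then have "d k \<le> (d k)\<^sup>2" by (simp only: norm mult_1_right flip: sum_distrib_left)
    with dk have d1: "d k \<ge> 1" by (simp add: power2_eq_square)
    define u where "u = (\<lambda>i. z i / a i)"
    have zu: "z i = u i * a i" if "i < n" for i using a[OF that] by (simp add: u_def)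
    \<comment> \<open>Perron argument: this sum equals \<open>2 - 2 * d k\<close>, so
      \<open>d k \<ge> 1\<close> makes it vanish, and \<open>u i = u j\<close> wherever
      \<open>H i j > 0\<close>.\<close>
    have "(\<Sum>i<n. \<Sum>j<n. H i j * a i * a j * (u i - u j)\<^sup>2)
        = (\<Sum>i<n. \<Sum>j<n. H i j * a i * a j * (u i)\<^sup>2) + (\<Sum>i<n. \<Sum>j<n. H i j * a i * a j * (u j)\<^sup>2) - 2 * bilin n H z z"
      unfolding bilin_def sum_distrib_left sum.distrib[symmetric] sum_subtractf[symmetric]
      by (intro sum.cong refl) (simp add: zu power2_eq_square algebra_simps)
    also have "(\<Sum>i<n. \<Sum>j<n. H i j * a i * a j * (u j)\<^sup>2) = (\<Sum>i<n. \<Sum>j<n. H i j * a i * a j * (u i)\<^sup>2)"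
      by (subst sum.swap, intro sum.cong refl) (simp add: sym)
    also have "(\<Sum>i<n. \<Sum>j<n. H i j * a i * a j * (u i)\<^sup>2) = (\<Sum>i<n. (\<Sum>j<n. H i j * a j) * (a i * (u i)\<^sup>2))"
      unfolding sum_distrib_right by (intro sum.cong refl) (simp add: mult_ac)
    also have "\<dots> = (\<Sum>i<n. D i * z i * z i)"
      by (intro sum.cong refl) (simp add: Da zu power2_eq_square)
    finally have "(\<Sum>i<n. \<Sum>j<n. H i j * a i * a j * (u i - u j)\<^sup>2) \<le> 0"
      using norm zz d1 by simp
    moreover have nn: "H i j * a i * a j * (u i - u j)\<^sup>2 \<ge> 0" if "i < n" "j < n" for i j
      using that nonneg a by (intro mult_nonneg_nonneg) (auto intro: less_imp_le)
    ultimately have total: "(\<Sum>i<n. \<Sum>j<n. H i j * a i * a j * (u i - u j)\<^sup>2) = 0"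
      by (intro antisym sum_nonneg nn) auto
    have rigid: "u i = u j" if "i < n" "j < n" "H i j > 0" for i j
    proof -
      have "(\<Sum>j<n. H i j * a i * a j * (u i - u j)\<^sup>2) = 0"
        by (rule sum_nonneg_0[OF _ _ total]) (auto simp: that(1) intro!: sum_nonneg nn simp del: mult_eq_0_iff zero_le_mult_iff)
      then have "H i j * a i * a j * (u i - u j)\<^sup>2 = 0"
        by (rule sum_nonneg_0[rotated 2]) (use that nn in auto)
      with that a[OF that(1)] a[OF that(2)] show ?thesis by simp
    qed
    have "p k i = u 0 * (s i * a i)" if i: "i < n" for i
    proof (cases "s i = 0")
      case True
      then show ?thesis using pk[OF i] by simp
    next
      case False
      have "\<exists>j<n. H i j \<noteq> 0"
      proof (rule ccontr)
        assume "\<not> (\<exists>j<n. H i j \<noteq> 0)"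
        then have "D i = 0" by (simp add: D_def)
        with False show False by (simp add: s_def)
      qed
      then obtain j where "j < n" "H i j > 0" using nonneg[OF i] by force
      \<comment> \<open>Index 0 is adjacent to every nonzero row, so \<open>u\<close> takes the
        value \<open>u 0\<close> at all of them. This connectedness makes the eigenvector unique up
        to a factor.\<close>
      then have "H i 0 > 0" using hub i by blast
      then have "u i = u 0" using rigid[OF i] i by simp
      then show ?thesis using pk[OF i] zu[OF i] by simp
    qed
    then show ?thesis by blast
  qed
  define y where "y = (\<lambda>i. s i * x i)"
  have "bilin n H x x = bilin n N y y"
    unfolding bilin_def y_def by (intro sum.cong refl) (simp add: HN mult_ac)
  also have "\<dots> = (\<Sum>k<n. d k * (\<Sum>i<n. p k i * y i) * (\<Sum>i<n. p k i * y i))"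
    by (rule bilin_eigen_expansion[OF Nd])
  also have "\<dots> \<le> 0"
  proof (rule sum_nonpos)
    fix k assume "k \<in> {..<n}"
    then have k: "k < n" by simp
    show "d k * (\<Sum>i<n. p k i * y i) * (\<Sum>i<n. p k i * y i) \<le> 0"
    proof (cases "d k > 0")
      case True
      from parallel[OF k True] obtain c where c: "\<And>i. i < n \<Longrightarrow> p k i = c * (s i * a i)" by blast
      \<comment> \<open>Pairing the multiple of D^(1/2) a with D^(1/2) x gives a multiple of H(x,a),
        which is 0.\<close>
      have "(\<Sum>i<n. p k i * y i) = (\<Sum>i<n. c * (x i * (D i * a i)))"
        by (intro sum.cong refl) (simp add: c y_def flip: ss)
      also have "\<dots> = c * bilin n H x a"
        unfolding bilin_eq_sum_left sum_distrib_left[symmetric] by (simp add: Da)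
      finally show ?thesis using orth by simp
    qed (simp add: mult.assoc mult_nonpos_nonneg)
  qed
  finally show ?thesis .
qed

text \<open>\<open>pos\<close> forces some eigenvalue to be positive. Two positive ones, even if
  equal, would have eigenvectors that form an orthogonal positive pair.\<close>

lemma num_pos_eigenvalues_eq_1:
  assumes sym: "\<And>i j. i < n \<Longrightarrow> j < n \<Longrightarrow> H i j = H j i"
    and pos: "bilin n H a a > 0"
    and neg: "\<And>x. bilin n H x a = 0 \<Longrightarrow> bilin n H x x \<le> 0"
  shows "num_pos_eigenvalues (mat n n (\<lambda>(i,j). H i j)) = 1"
proof -
  let ?A = "mat n n (\<lambda>(i,j). H i j)"
  obtain p d where
    on: "\<And>k l. k < n \<Longrightarrow> l < n \<Longrightarrow> (\<Sum>i<n. p k i * p l i) = (if k = l then 1 else 0)"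
    and Hd: "\<And>i j. i < n \<Longrightarrow> j < n \<Longrightarrow> H i j = (\<Sum>k<n. d k * p k i * p k j)"
    and cp: "char_poly ?A = (\<Prod>k<n. [:- d k, 1:])"
    by (rule symmetric_real_eigenbasis[OF sym]) blast+
  have ex: "bilin n H x y = (\<Sum>k<n. d k * (\<Sum>i<n. p k i * x i) * (\<Sum>j<n. p k j * y j))" for x y
    by (rule bilin_eigen_expansion[OF Hd])
  have pp: "bilin n H (p k) (p l) = (if k = l then d k else 0)" if "k < n" "l < n" for k l
  proof -
    have "bilin n H (p k) (p l) = (\<Sum>m<n. d m * (if m = k then 1 else 0) * (if m = l then 1 else 0))"
      unfolding ex using that by (intro sum.cong refl) (simp add: on)
    then show ?thesis using that by (simp add: if_distrib cong: if_cong)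
  qed
  have "\<exists>k<n. d k > 0"
  proof (rule ccontr)
    assume "\<not> (\<exists>k<n. d k > 0)"
    then have "d k * (\<Sum>i<n. p k i * a i) * (\<Sum>i<n. p k i * a i) \<le> 0" if "k < n" for k
      using that unfolding mult.assoc by (intro mult_nonpos_nonneg) auto
    then have "bilin n H a a \<le> 0" unfolding ex by (intro sum_nonpos) auto
    with pos show False by simp
  qed
  then obtain k where k: "k < n" "d k > 0" by blast
  have uniq: "l = k" if "l < n" "d l > 0" for l
  proof (rule ccontr)
    assume "l \<noteq> k"
    then have "bilin n H (p l) (p k) = 0" "bilin n H (p l) (p l) > 0" "bilin n H (p k) (p k) > 0"
      using that k by (simp_all add: pp)
    then show False
      by (intro no_orthogonal_positive_pair[where n = n and H = H and v = a and x = "p l" and y = "p k"] sym neg)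
  qed
  have ev: "eigenvalue ?A e \<longleftrightarrow> (\<exists>l<n. d l = e)" for e
  proof -
    have "eigenvalue ?A e \<longleftrightarrow> poly (\<Prod>k<n. [:- d k, 1:]) e = 0"
      unfolding cp[symmetric] by (rule eigenvalue_root_char_poly[of _ n]) simp
    also have "\<dots> \<longleftrightarrow> (\<exists>l<n. e - d l = 0)" by (simp add: poly_prod Bex_def)
    also have "\<dots> \<longleftrightarrow> (\<exists>l<n. d l = e)" by auto
    finally show ?thesis .
  qed
  have "{e. eigenvalue ?A e \<and> 0 < e} = {d k}" unfolding ev using k uniq by blast
  then have "num_pos_eigenvalues ?A = order (d k) (\<Prod>l<n. [:- d l, 1:])"
    by (simp add: num_pos_eigenvalues_def cp)
  also have "\<dots> = 1"
  proof -
    \<comment> \<open>The other linear factors do not vanish at \<open>d k\<close>, so its algebraic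
      multiplicity is exactly 1.\<close>
    define R where "R = (\<Prod>l\<in>{..<n} - {k}. [:- d l, 1:])"
    have split: "(\<Prod>l<n. [:- d l, 1:]) = [:- d k, 1:] ^ 1 * R"
      unfolding R_def power_one_right using k(1) by (intro prod.remove) auto
    have "d l \<noteq> d k" if "l \<in> {..<n} - {k}" for l using uniq[of l] k(2) that by force
    then have R: "poly R (d k) \<noteq> 0" by (fastforce simp: R_def poly_prod)
    then have "R \<noteq> 0" by auto
    then have "[:- d k, 1:] ^ 1 * R \<noteq> 0" unfolding mult_eq_0_iff power_one_right by simp
    then have "order (d k) ([:- d k, 1:] ^ 1 * R) = order (d k) ([:- d k, 1:] ^ 1) + order (d k) R"
      by (rule order_mult)
    then show ?thesis unfolding split using order_power_n_n[of "d k" 1] order_0I[OF R] by linarith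
  qed
  finally show ?thesis .
qed

section \<open>Matroid rank and parallel classes\<close>

context matroid
begin

lemma finite_indep_cards: "finite {card X |X. X \<subseteq> A \<and> indep X}"
proof -
  have "finite {X. indep X}"
    by (rule finite_subset[of _ "Pow E"]) (auto dest: indep_subset_ground simp: finite_ground)
  moreover have "{card X |X. X \<subseteq> A \<and> indep X} \<subseteq> card ` {X. indep X}" by auto
  ultimately show ?thesis by (rule finite_surj)
qed

lemma finite_indep: "indep X \<Longrightarrow> finite X"
  using indep_subset_ground finite_ground finite_subset by blast

lemma card_le_rank: "indep X \<Longrightarrow> X \<subseteq> A \<Longrightarrow> card X \<le> matroid_rank indep A"
  unfolding matroid_rank_def by (rule Max_ge[OF finite_indep_cards]) auto

lemma rank_basis: "\<exists>X. X \<subseteq> A \<and> indep X \<and> card X = matroid_rank indep A"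
proof -
  have "matroid_rank indep A \<in> {card X |X. X \<subseteq> A \<and> indep X}"
    unfolding matroid_rank_def using indep_empty by (intro Max_in[OF finite_indep_cards]) auto
  then show ?thesis by auto
qed

lemma rank_mono: "A \<subseteq> B \<Longrightarrow> matroid_rank indep A \<le> matroid_rank indep B"
  by (metis rank_basis card_le_rank order_trans)

lemma rank_insert_le: "matroid_rank indep (insert i A) \<le> Suc (matroid_rank indep A)"
proof -
  obtain X where X: "X \<subseteq> insert i A" "indep X" "card X = matroid_rank indep (insert i A)"
    using rank_basis by blast
  have "card (X - {i}) \<le> matroid_rank indep A"
    using X indep_mono[of X "X - {i}"] by (intro card_le_rank) auto
  moreover have "card X \<le> Suc (card (X - {i}))"
    using finite_indep[OF X(2)] by (metis card_Diff_singleton_if diff_Suc_1 le_SucI order_refl Suc_pred card_gt_0_iff empty_iff)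
  ultimately show ?thesis using X by linarith
qed

text \<open>\<open>I\<close> is augmented repeatedly from a largest independent subset of
  \<open>A\<close>; each time the gap between the rank and \<open>card I\<close> shrinks.\<close>

lemma indep_extends_to_basis:
  assumes "indep I" "I \<subseteq> A"
  shows "\<exists>J. I \<subseteq> J \<and> J \<subseteq> A \<and> indep J \<and> card J = matroid_rank indep A"
  using assms
proof (induction "matroid_rank indep A - card I" arbitrary: I rule: less_induct)
  case less
  show ?case
  proof (cases "card I < matroid_rank indep A")
    case False
    then show ?thesis using less.prems card_le_rank[of I A] by (intro exI[of _ I]) auto
  next
    case True
    obtain X where X: "X \<subseteq> A" "indep X" "card X = matroid_rank indep A"
      using rank_basis by blast
    with True augment[of X I] less.prems obtain x where x: "x \<in> X - I" "indep (insert x I)" by auto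
    have "card (insert x I) = Suc (card I)" using x finite_indep[OF less.prems(1)] by simp
    with True have "matroid_rank indep A - card (insert x I) < matroid_rank indep A - card I" by simp
    from less.hyps[OF this x(2)] x X less.prems show ?thesis by auto
  qed
qed

text \<open>If \<open>i\<close> raises the rank of A + j, take nested bases \<open>I\<close>,
  \<open>J\<close>, \<open>K\<close> of A, A + j and A + i + j. \<open>K\<close> must contain
  \<open>i\<close>, so I + i is independent and \<open>i\<close> also raises the rank of A.\<close>

lemma rank_insert_submodular:
  "matroid_rank indep (insert i (insert j A)) + matroid_rank indep A
    \<le> matroid_rank indep (insert i A) + matroid_rank indep (insert j A)"
proof (cases "matroid_rank indep (insert i (insert j A)) = matroid_rank indep (insert j A)")
  case True
  then show ?thesis using rank_mono[OF subset_insertI[of A i]] by simp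
next
  case False
  then have suc: "matroid_rank indep (insert i (insert j A)) = Suc (matroid_rank indep (insert j A))"
    using rank_mono[OF subset_insertI[of "insert j A" i]] rank_insert_le[of i "insert j A"] by auto
  obtain I where I: "I \<subseteq> A" "indep I" "card I = matroid_rank indep A" using rank_basis by blast
  obtain J where J: "I \<subseteq> J" "J \<subseteq> insert j A" "indep J" "card J = matroid_rank indep (insert j A)"
    using indep_extends_to_basis[of I "insert j A"] I by blast
  obtain K where K: "J \<subseteq> K" "K \<subseteq> insert i (insert j A)" "indep K"
    "card K = matroid_rank indep (insert i (insert j A))"
    using indep_extends_to_basis[of J "insert i (insert j A)"] J by blast
  have "i \<in> K"
  proof (rule ccontr)
    assume "i \<notin> K"
    then have "card K \<le> matroid_rank indep (insert j A)" using K by (intro card_le_rank) auto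
    with K suc show False by simp
  qed
  have "i \<notin> A" using False by (metis insertI2 insert_absorb)
  then have "i \<notin> I" using I by auto
  have "indep (insert i I)" using indep_mono[OF K(3)] \<open>i \<in> K\<close> J K by auto
  then have "card (insert i I) \<le> matroid_rank indep (insert i A)" using I by (intro card_le_rank) auto
  then show ?thesis using suc I finite_indep[OF I(2)] \<open>i \<notin> I\<close> by simp
qed

end

section \<open>Cauchy--Schwarz inequalities over the classes of a partition\<close>

lemma sum_squared_le_card_mult_sum_squares:
  fixes g :: "'a \<Rightarrow> real"
  assumes "finite T"
  shows "(\<Sum>t\<in>T. g t)\<^sup>2 \<le> real (card T) * (\<Sum>t\<in>T. (g t)\<^sup>2)"
proof (cases "T = {}")
  case False
  then have c: "real (card T) > 0" using assms by (simp add: card_gt_0_iff)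
  \<comment> \<open>\<open>m\<close> is the mean of \<open>g\<close>; the inequality is the
    nonnegativity of the variance.\<close>
  define m where "m = (\<Sum>t\<in>T. g t) / real (card T)"
  have s: "(\<Sum>t\<in>T. g t) = real (card T) * m" using c by (simp add: m_def)
  have "0 \<le> (\<Sum>t\<in>T. (g t - m)\<^sup>2)" by (rule sum_nonneg) simp
  also have "\<dots> = (\<Sum>t\<in>T. (g t)\<^sup>2 - 2 * m * g t + m\<^sup>2)"
    by (intro sum.cong) (auto simp: power2_diff)
  also have "\<dots> = (\<Sum>t\<in>T. (g t)\<^sup>2) - real (card T) * m\<^sup>2"
    by (simp add: sum.distrib sum_subtractf sum_distrib_left[symmetric] s power2_eq_square)
  finally have "real (card T) * (real (card T) * m\<^sup>2) \<le> real (card T) * (\<Sum>t\<in>T. (g t)\<^sup>2)"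
    using c by (intro mult_left_mono) auto
  then show ?thesis unfolding s by (simp add: power2_eq_square mult_ac)
qed simp

text \<open>The double sum is the sum of the squares of the class sums, and \<open>c\<close> splits
  \<open>V\<close> into at most \<open>card V\<close> classes.\<close>

lemma sum_squared_le_card_mult_partition_sum:
  fixes z :: "'a \<Rightarrow> real" and c :: "'a \<Rightarrow> 'b"
  assumes V: "finite V"
  shows "(\<Sum>i\<in>V. z i)\<^sup>2 \<le> real (card V) * (\<Sum>i\<in>V. \<Sum>j\<in>V. if c i = c j then z i * z j else 0)"
proof -
  define g where "g = (\<lambda>t. \<Sum>i | i \<in> V \<and> c i = t. z i)"
  have T: "finite (c ` V)" "card (c ` V) \<le> card V" using V by (auto intro: card_image_le)
  have "(\<Sum>i\<in>V. z i) = (\<Sum>t\<in>c ` V. g t)"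
    unfolding g_def by (rule sum.image_gen[OF V])
  then have "(\<Sum>i\<in>V. z i)\<^sup>2 \<le> real (card (c ` V)) * (\<Sum>t\<in>c ` V. (g t)\<^sup>2)"
    using sum_squared_le_card_mult_sum_squares[OF T(1)] by simp
  also have "\<dots> \<le> real (card V) * (\<Sum>t\<in>c ` V. (g t)\<^sup>2)"
    using T by (intro mult_right_mono sum_nonneg) auto
  also have "(\<Sum>t\<in>c ` V. (g t)\<^sup>2) = (\<Sum>t\<in>c ` V. \<Sum>i | i \<in> V \<and> c i = t. z i * g (c i))"
    by (intro sum.cong refl) (simp add: g_def power2_eq_square sum_distrib_right)
  also have "\<dots> = (\<Sum>i\<in>V. z i * g (c i))" by (rule sum.image_gen[OF V, symmetric])
  also have "\<dots> = (\<Sum>i\<in>V. \<Sum>j\<in>V. if c i = c j then z i * z j else 0)"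
  proof (intro sum.cong refl)
    fix i
    have "z i * g (c i) = (\<Sum>j | j \<in> V \<and> c i = c j. z i * z j)"
      unfolding g_def sum_distrib_left by (intro sum.cong) auto
    also have "\<dots> = (\<Sum>j\<in>V. if c i = c j then z i * z j else 0)" by (rule sum.inter_filter[OF V])
    finally show "z i * g (c i) = (\<Sum>j\<in>V. if c i = c j then z i * z j else 0)" .
  qed
  finally show ?thesis .
qed

section \<open>Parallel elements of contractions, from local rank axioms\<close>

locale rank_function =
  fixes r :: "nat set \<Rightarrow> nat"
  assumes mono: "A \<subseteq> B \<Longrightarrow> r A \<le> r B"
    and insert_le: "r (insert i A) \<le> Suc (r A)"
    and submodular: "r (insert i (insert j A)) + r A \<le> r (insert i A) + r (insert j A)"
begin

text \<open>Parallelism in the contraction by \<open>S\<close>: nonloops that together have rank 1.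
  The disjunct \<open>i = j\<close> makes each loop of the contraction a class of its own, so that
  an equivalence relation results.\<close>

definition parallel :: "nat set \<Rightarrow> nat \<Rightarrow> nat \<Rightarrow> bool" where
  "parallel S i j \<longleftrightarrow> i = j \<or>
     r (insert i S) = Suc (r S) \<and> r (insert j S) = Suc (r S) \<and> r (insert i (insert j S)) = Suc (r S)"

lemma parallel_refl: "parallel S i i"
  by (simp add: parallel_def)

lemma parallel_sym: "parallel S i j \<Longrightarrow> parallel S j i"
  by (auto simp: parallel_def insert_commute)

text \<open>Neither \<open>i\<close> nor \<open>k\<close> raises the rank of S + j, so by
  submodularity S + i + j + k still has rank at most \<open>Suc (r S)\<close>.\<close>

lemma parallel_trans:
  assumes "parallel S i j" "parallel S j k"
  shows "parallel S i k"
proof (cases "i = j \<or> j = k")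
  case False
  with assms have r: "r (insert i S) = Suc (r S)" "r (insert j S) = Suc (r S)" "r (insert k S) = Suc (r S)"
      "r (insert i (insert j S)) = Suc (r S)" "r (insert j (insert k S)) = Suc (r S)"
    by (auto simp: parallel_def)
  have "r (insert i (insert k (insert j S))) + r (insert j S) \<le> r (insert i (insert j S)) + r (insert k (insert j S))"
    by (rule submodular)
  then have "r (insert i (insert k (insert j S))) \<le> Suc (r S)" using r by (simp add: insert_commute)
  moreover have "r (insert i (insert k S)) \<le> r (insert i (insert k (insert j S)))" by (rule mono) auto
  moreover have "r (insert i S) \<le> r (insert i (insert k S))" by (rule mono) auto
  ultimately show ?thesis using r by (simp add: parallel_def)
qed (use assms in auto)

text \<open>For distinct elements, submodularity has defect 1 at parallel pairs and 0 otherwise.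
  This defect becomes the factor \<open>q\<close> in the Hessian.\<close>

lemma rank_insert_insert:
  assumes "i \<noteq> j"
  shows "r (insert i S) + r (insert j S) = r S + r (insert i (insert j S)) + (if parallel S i j then 1 else 0)"
proof -
  have m: "r S \<le> r (insert i S)" "r S \<le> r (insert j S)" "r (insert i S) \<le> r (insert i (insert j S))"
    "r (insert j S) \<le> r (insert i (insert j S))" by (rule mono; auto)+
  have "r (insert i S) \<le> Suc (r S)" "r (insert j S) \<le> Suc (r S)" by (rule insert_le)+
  with m submodular[of i j S] assms show ?thesis by (auto simp: parallel_def)
qed

text \<open>
  The form equals \<open>(\<Sum>z)\<^sup>2 - (1 - q) P - q Q\<close>, where \<open>P\<close> and \<open>Q\<close> add up the squares of the sums of \<open>z\<close> over the
  parallel classes and over the singletons; either partition has at most \<open>card V\<close> parts.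
\<close>

lemma parallel_form_le:
  assumes V: "finite V" and q: "0 < q" "q \<le> 1"
  shows "real (card V) * (\<Sum>i\<in>V. \<Sum>j\<in>V. (if i = j then 0 else if parallel S i j then q else 1) * z i * z j)
    \<le> (real (card V) - 1) * (\<Sum>i\<in>V. z i)\<^sup>2"
proof -
  let ?N = "real (card V)"
  let ?Z = "(\<Sum>i\<in>V. z i)\<^sup>2"
  define c where "c = (\<lambda>i. {j. parallel S i j})"
  have c: "c i = c j \<longleftrightarrow> parallel S i j" for i j
    unfolding c_def using parallel_refl parallel_sym parallel_trans by blast
  define P where "P = (\<Sum>i\<in>V. \<Sum>j\<in>V. if c i = c j then z i * z j else 0)"
  define Q where "Q = (\<Sum>i\<in>V. \<Sum>j\<in>V. if i = j then z i * z j else 0)"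
  have P: "?Z \<le> ?N * P" unfolding P_def by (rule sum_squared_le_card_mult_partition_sum[OF V])
  have Q: "?Z \<le> ?N * Q" unfolding Q_def
    using sum_squared_le_card_mult_partition_sum[OF V, of z "\<lambda>i. i"] by simp
  have ZZ: "?Z = (\<Sum>i\<in>V. \<Sum>j\<in>V. z i * z j)" by (simp add: power2_eq_square sum_product)
  \<comment> \<open>Coefficientwise: 1 - (1 - q) - q = 0 on the diagonal, which occurs in both
    \<open>P\<close> and \<open>Q\<close>; 1 - (1 - q) = q at the other parallel pairs; and 1
    elsewhere.\<close>
  have eq: "(\<Sum>i\<in>V. \<Sum>j\<in>V. (if i = j then 0 else if parallel S i j then q else 1) * z i * z j)
      = ?Z - (1 - q) * P - q * Q"
    unfolding ZZ P_def Q_def sum_distrib_left sum_subtractf[symmetric]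
    by (intro sum.cong refl) (auto simp: c parallel_refl algebra_simps)
  \<comment> \<open>Since \<open>0 < q\<close> and \<open>q \<le> 1\<close>, the bounds for
    \<open>P\<close> and \<open>Q\<close> are combined with nonnegative weights of sum 1.\<close>
  have "(1 - q) * ?Z \<le> (1 - q) * (?N * P)" using q P by (intro mult_left_mono) auto
  moreover have "q * ?Z \<le> q * (?N * Q)" using q Q by (intro mult_left_mono) auto
  ultimately show ?thesis unfolding eq by (simp add: algebra_simps)
qed

end

section \<open>Derivatives of the multivariate Tutte polynomial\<close>

text \<open>
  For \<open>f A = q powi (- rk A)\<close> and \<open>N = card ({1..n} - S)\<close>, this is the Tutte polynomial differentiated once in each
  \<open>w i\<close>, \<open>i \<in> S\<close>, and \<open>N - d\<close> times in \<open>w 0\<close>; the latter produces the quotient of factorials.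
\<close>

definition potts :: "nat \<Rightarrow> (nat set \<Rightarrow> real) \<Rightarrow> (nat \<Rightarrow> real) \<Rightarrow> nat set \<Rightarrow> nat \<Rightarrow> real" where
  "potts n f w S d = (\<Sum>A | A \<subseteq> {1..n} - S \<and> card A \<le> d.
     fact (card ({1..n} - S) - card A) / fact (d - card A) * f (A \<union> S) * (\<Prod>i\<in>A. w i) * w 0 ^ (d - card A))"

text \<open>The partial derivative in \<open>w j\<close>, expressed on the indices \<open>S\<close>, \<open>d\<close> of the family \<^const>\<open>potts\<close>.\<close>

definition partial_op :: "nat \<Rightarrow> (nat set \<Rightarrow> nat \<Rightarrow> real) \<Rightarrow> nat set \<Rightarrow> nat \<Rightarrow> real" where
  "partial_op j F S d = (if j = 0 then F S (d - 1) else if j \<in> S then 0 else F (insert j S) (d - 1))"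

lemma partial_op_commute: "partial_op i (partial_op j F) = partial_op j (partial_op i F)"
  by (intro ext) (auto simp: partial_op_def insert_commute)

lemma tutte_Z_eq_potts:
  "tutte_Z n indep q w = potts n (\<lambda>A. q powi (- int (matroid_rank indep A))) w {} n"
proof -
  let ?g = "\<lambda>A. q powi (- int (matroid_rank indep A)) * (\<Prod>i\<in>A. w i) * w 0 ^ (n - card A)"
  let ?P = "Pow {1..n}"
  have le: "card A \<le> n" if "A \<subseteq> {1..n}" for A :: "nat set"
    using card_mono[OF _ that] by simp
  have "tutte_Z n indep q w = (\<Sum>k\<in>{0..n}. \<Sum>A | A \<in> ?P \<and> n - card A = k. ?g A)"
    unfolding tutte_Z_def Z_part_def sum_distrib_right
  proof (intro sum.cong refl)
    fix k A assume "k \<in> {0..n}"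
    then have "(A \<subseteq> {1..n} \<and> card A = n - k) \<longleftrightarrow> (A \<subseteq> {1..n} \<and> n - card A = k)" for A
      using le[of A] by auto
    then show "{A. A \<subseteq> {1..n} \<and> card A = n - k} = {A \<in> ?P. n - card A = k}" by auto
  qed auto
  also have "\<dots> = (\<Sum>A\<in>?P. ?g A)" by (rule sum.group) auto
  \<comment> \<open>For \<open>S = {}\<close> and \<open>d = n\<close> the factorials
    cancel.\<close>
  also have "\<dots> = potts n (\<lambda>A. q powi (- int (matroid_rank indep A))) w {} n"
    unfolding potts_def by (rule sum.cong) (use le in auto)
  finally show ?thesis .
qed

lemma finite_potts_index [simp]: "finite {A. A \<subseteq> {1..n::nat} - S \<and> card A \<le> d}"
  by (rule finite_subset[of _ "Pow {1..n}"]) auto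

lemma potts_pos:
  assumes "\<And>i. i \<le> n \<Longrightarrow> 0 < w i" and "\<And>A. 0 < f A"
  shows "0 < potts n f w S d"
  unfolding potts_def
proof (rule sum_pos2[of _ "{}"])
  fix A assume "A \<in> {A. A \<subseteq> {1..n} - S \<and> card A \<le> d}"
  then have "0 \<le> (\<Prod>i\<in>A. w i)" by (intro prod_nonneg less_imp_le[OF assms(1)]) auto
  then show "0 \<le> fact (card ({1..n} - S) - card A) / fact (d - card A) * f (A \<union> S) * (\<Prod>i\<in>A. w i) * w 0 ^ (d - card A)"
    using less_imp_le[OF assms(1)[of 0]] less_imp_le[OF assms(2)[of "A \<union> S"]] by simp
qed (use assms in auto)

section \<open>Differentiation within the family \<open>potts\<close>\<close>

lemma sum_insert_reindex:
  fixes F :: "nat set \<Rightarrow> real"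
  assumes j: "j \<in> {1..n} - S" and d: "d \<ge> 1"
  shows "(\<Sum>A | A \<subseteq> {1..n} - insert j S \<and> card A \<le> d - 1. F (insert j A))
    = (\<Sum>A | A \<subseteq> {1..n} - S \<and> card A \<le> d \<and> j \<in> A. F A)"
proof (rule sum.reindex_bij_witness[where i = "\<lambda>A. A - {j}" and j = "insert j"])
  fix A assume A: "A \<in> {A. A \<subseteq> {1..n} - insert j S \<and> card A \<le> d - 1}"
  then have "finite A" "j \<notin> A" using finite_subset[of A "{1..n}"] by auto
  then show "insert j A \<in> {A. A \<subseteq> {1..n} - S \<and> card A \<le> d \<and> j \<in> A}" "insert j A - {j} = A"
    using A j d by auto
next
  fix A assume A: "A \<in> {A. A \<subseteq> {1..n} - S \<and> card A \<le> d \<and> j \<in> A}"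
  then have "finite A" using finite_subset[of A "{1..n}"] by auto
  with A show "insert j (A - {j}) = A" "A - {j} \<in> {A. A \<subseteq> {1..n} - insert j S \<and> card A \<le> d - 1}"
    by auto
qed auto

text \<open>The right side is the derivative in \<open>w j\<close>: terms with \<open>j\<close> in
  \<open>A\<close> survive and lose that factor. Removing \<open>j\<close> lowers
  \<open>card A\<close>, \<open>d\<close> and \<open>card ({1..n} - S)\<close> by one each, so the
  factorial quotient is unchanged.\<close>

lemma potts_insert:
  assumes j: "j \<in> {1..n} - S" and d: "d \<ge> 1"
  shows "potts n f w (insert j S) (d - 1) = (\<Sum>A | A \<subseteq> {1..n} - S \<and> card A \<le> d \<and> j \<in> A.
     fact (card ({1..n} - S) - card A) / fact (d - card A) * f (A \<union> S) * (\<Prod>i\<in>A - {j}. w i) * w 0 ^ (d - card A))"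
proof -
  have "card ({1..n} - insert j S) = card ({1..n} - S) - 1"
    using j by (metis Diff_insert card_Diff_singleton)
  then have "potts n f w (insert j S) (d - 1) = (\<Sum>A | A \<subseteq> {1..n} - insert j S \<and> card A \<le> d - 1.
     (\<lambda>A. fact (card ({1..n} - S) - card A) / fact (d - card A) * f (A \<union> S) * (\<Prod>i\<in>A - {j}. w i) * w 0 ^ (d - card A)) (insert j A))"
    unfolding potts_def
  proof (intro sum.cong refl)
    fix A assume A: "A \<in> {A. A \<subseteq> {1..n} - insert j S \<and> card A \<le> d - 1}"
    then have "finite A" "j \<notin> A" using finite_subset[of A "{1..n}"] by auto
    then have "card (insert j A) = Suc (card A)" "insert j A - {j} = A" by auto
    then show "fact (card ({1..n} - insert j S) - card A) / fact (d - 1 - card A) * f (A \<union> insert j S) * (\<Prod>i\<in>A. w i) * w 0 ^ (d - 1 - card A) =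
      (\<lambda>A. fact (card ({1..n} - S) - card A) / fact (d - card A) * f (A \<union> S) * (\<Prod>i\<in>A - {j}. w i) * w 0 ^ (d - card A)) (insert j A)"
      using \<open>card ({1..n} - insert j S) = _\<close> by simp
  qed
  also have "\<dots> = (\<Sum>A | A \<subseteq> {1..n} - S \<and> card A \<le> d \<and> j \<in> A.
     fact (card ({1..n} - S) - card A) / fact (d - card A) * f (A \<union> S) * (\<Prod>i\<in>A - {j}. w i) * w 0 ^ (d - card A))"
    by (rule sum_insert_reindex[OF assms])
  finally show ?thesis .
qed

text \<open>The right side is the derivative in \<open>w 0\<close>, which takes
  \<open>w 0 ^ m / fact m\<close> to the same expression for \<open>m - 1\<close>. Terms with
  \<open>card A = d\<close>, absent on the left, carry the factor 0 on the right.\<close>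

lemma potts_pred:
  assumes d: "d \<ge> 1"
  shows "potts n f w S (d - 1) = (\<Sum>A | A \<subseteq> {1..n} - S \<and> card A \<le> d.
     fact (card ({1..n} - S) - card A) / fact (d - card A) * f (A \<union> S) * (\<Prod>i\<in>A. w i) * (real (d - card A) * w 0 ^ (d - card A - 1)))"
  unfolding potts_def
proof (rule sum.mono_neutral_cong_left)
  fix A assume "A \<in> {A. A \<subseteq> {1..n} - S \<and> card A \<le> d - 1}"
  then obtain m where m: "d - card A = Suc m" "d - 1 - card A = m" using d by (cases "d - card A") auto
  have cancel: "x / fact m = x / fact (Suc m) * real (Suc m)" for x :: real
    unfolding fact_Suc by (simp del: of_nat_Suc)
  then show "fact (card ({1..n} - S) - card A) / fact (d - 1 - card A) * f (A \<union> S) * (\<Prod>i\<in>A. w i) * w 0 ^ (d - 1 - card A) =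
    fact (card ({1..n} - S) - card A) / fact (d - card A) * f (A \<union> S) * (\<Prod>i\<in>A. w i) * (real (d - card A) * w 0 ^ (d - card A - 1))"
    unfolding m by (subst cancel) (simp only: diff_Suc_1 mult_ac)
qed auto

text \<open>For positive \<open>j\<close> the sum is affine in \<open>w j\<close>, and its slope
  comes from the sets \<open>A\<close> that contain \<open>j\<close>; there are none if
  \<open>j\<close> lies in \<open>S\<close>.\<close>

lemma partial_deriv_potts:
  assumes j: "j \<le> n" and d: "d \<ge> 1"
  shows "partial_deriv j (\<lambda>w. potts n f w S d) w = partial_op j (potts n f w) S d"
proof -
  let ?I = "{A. A \<subseteq> {1..n} - S \<and> card A \<le> d}"
  let ?c = "\<lambda>A. fact (card ({1..n} - S) - card A) / fact (d - card A) * f (A \<union> S) :: real"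
  have P: "partial_deriv j (\<lambda>w. potts n f w S d) w = D"
    if "((\<lambda>t. potts n f (w(j := t)) S d) has_real_derivative D) (at (w j))" for D
    unfolding partial_deriv_def by (rule DERIV_imp_deriv[OF that])
  show ?thesis
  proof (cases "j = 0")
    case True
    have "(\<Prod>i\<in>A. (w(0 := t)) i) = (\<Prod>i\<in>A. w i)" if "A \<in> ?I" for A t
      using that by (intro prod.cong) auto
    then have "potts n f (w(0 := t)) S d = (\<Sum>A\<in>?I. ?c A * (\<Prod>i\<in>A. w i) * t ^ (d - card A))" for t
      unfolding potts_def by (intro sum.cong refl) simp
    moreover have "((\<lambda>t. \<Sum>A\<in>?I. ?c A * (\<Prod>i\<in>A. w i) * t ^ (d - card A)) has_real_derivative
        (\<Sum>A\<in>?I. ?c A * (\<Prod>i\<in>A. w i) * (real (d - card A) * w 0 ^ (d - card A - 1)))) (at (w 0))"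
      by (intro DERIV_sum DERIV_cmult) (auto intro!: derivative_eq_intros)
    ultimately have "((\<lambda>t. potts n f (w(j := t)) S d) has_real_derivative potts n f w S (d - 1)) (at (w j))"
      unfolding potts_pred[OF d] True by (simp only:)
    then show ?thesis using P True by (simp add: partial_op_def)
  next
    case False
    let ?J = "{A. A \<subseteq> {1..n} - S \<and> card A \<le> d \<and> j \<in> A}"
    let ?K = "{A. A \<subseteq> {1..n} - S \<and> card A \<le> d \<and> j \<notin> A}"
    let ?D = "\<Sum>A\<in>?J. ?c A * (\<Prod>i\<in>A - {j}. w i) * w 0 ^ (d - card A)"
    have fin: "finite ?J" "finite ?K" by (rule finite_subset[OF _ finite_potts_index[of n S d]]; auto)+
    have in_J: "(\<Prod>i\<in>A. (w(j := t)) i) = t * (\<Prod>i\<in>A - {j}. w i)" if "A \<in> ?J" for A t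
    proof -
      have "finite A" using that finite_subset[of A "{1..n}"] by auto
      then have "(\<Prod>i\<in>A. (w(j := t)) i) = t * (\<Prod>i\<in>A - {j}. (w(j := t)) i)"
        using that by (subst prod.remove[of _ j]) auto
      also have "(\<Prod>i\<in>A - {j}. (w(j := t)) i) = (\<Prod>i\<in>A - {j}. w i)" by (intro prod.cong) auto
      finally show ?thesis .
    qed
    have in_K: "(\<Prod>i\<in>A. (w(j := t)) i) = (\<Prod>i\<in>A. w i)" if "A \<in> ?K" for A t
      using that by (intro prod.cong) auto
    have "potts n f (w(j := t)) S d = t * ?D + (\<Sum>A\<in>?K. ?c A * (\<Prod>i\<in>A. w i) * w 0 ^ (d - card A))" for t
    proof -
      have "?I = ?J \<union> ?K" by auto
      then have "potts n f (w(j := t)) S d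
          = (\<Sum>A\<in>?J. ?c A * (\<Prod>i\<in>A. (w(j := t)) i) * w 0 ^ (d - card A)) + (\<Sum>A\<in>?K. ?c A * (\<Prod>i\<in>A. (w(j := t)) i) * w 0 ^ (d - card A))"
        unfolding potts_def using fin False by (subst sum.union_disjoint[symmetric]) auto
      also have "(\<Sum>A\<in>?J. ?c A * (\<Prod>i\<in>A. (w(j := t)) i) * w 0 ^ (d - card A)) = t * ?D"
        unfolding sum_distrib_left
      proof (intro sum.cong refl)
        fix A assume "A \<in> ?J"
        then show "?c A * (\<Prod>i\<in>A. (w(j := t)) i) * w 0 ^ (d - card A)
            = t * (?c A * (\<Prod>i\<in>A - {j}. w i) * w 0 ^ (d - card A))"
          by (subst in_J) (simp_all only: mult_ac)
      qed
      also have "(\<Sum>A\<in>?K. ?c A * (\<Prod>i\<in>A. (w(j := t)) i) * w 0 ^ (d - card A))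
          = (\<Sum>A\<in>?K. ?c A * (\<Prod>i\<in>A. w i) * w 0 ^ (d - card A))"
        by (intro sum.cong refl arg_cong2[of _ _ _ _ "(*)"] in_K)
      finally show ?thesis .
    qed
    then have "((\<lambda>t. potts n f (w(j := t)) S d) has_real_derivative ?D) (at (w j))"
      by (auto intro!: derivative_eq_intros)
    then have eq: "partial_deriv j (\<lambda>w. potts n f w S d) w = ?D" by (rule P)
    show ?thesis
    proof (cases "j \<in> S")
      case True
      then have empty: "?J = {}" by auto
      show ?thesis using True False unfolding eq empty by (simp add: partial_op_def)
    next
      case jS: False
      with False j have "j \<in> {1..n} - S" by auto
      from potts_insert[OF this d] eq False jS show ?thesis by (simp add: partial_op_def)
    qed
  qed
qed

lemma hessian_potts:
  assumes d: "d \<ge> 2"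
  shows "hessian (n + 1) (\<lambda>w. potts n f w S d) w = mat (n + 1) (n + 1) (\<lambda>(i, j). partial_op i (partial_op j (potts n f w)) S d)"
proof -
  have "partial_deriv i (partial_deriv j (\<lambda>w. potts n f w S d)) w = partial_op i (partial_op j (potts n f w)) S d"
    if i: "i \<le> n" and j: "j \<le> n" for i j
  proof -
    have "partial_deriv j (\<lambda>w. potts n f w S d) = (\<lambda>w. partial_op j (potts n f w) S d)"
      using partial_deriv_potts[OF j, of d f S] d by auto
    \<comment> \<open>Since \<open>partial_op\<close> acts on the indices, the variable
      differentiated first ends up outermost; commutation restores the stated order.\<close>
    moreover have "partial_deriv i (\<lambda>w. partial_op j (potts n f w) S d) w = partial_op j (partial_op i (potts n f w)) S d"
    proof -
      have "partial_deriv i (\<lambda>w. 0) w = 0" by (simp add: partial_deriv_def)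
      then show ?thesis
        using partial_deriv_potts[OF i, of "d - 1" f] d by (simp add: partial_op_def[of j])
    qed
    ultimately show ?thesis by (simp add: partial_op_commute)
  qed
  then show ?thesis unfolding hessian_def by (intro eq_matI) auto
qed

text \<open>Homogeneity of degree \<open>d\<close>, by double counting: the term of \<open>A\<close>
  occurs once for each \<open>j\<close> in \<open>A\<close> and \<open>d - card A\<close> times
  through \<open>w 0\<close>.\<close>

lemma potts_euler:
  assumes S: "S \<subseteq> {1..n}" and d: "d \<ge> 1"
  shows "(\<Sum>j<n + 1. w j * partial_op j (potts n f w) S d) = real d * potts n f w S d"
proof -
  let ?V = "{1..n} - S"
  let ?I = "{A. A \<subseteq> ?V \<and> card A \<le> d}"
  let ?t = "\<lambda>A. fact (card ?V - card A) / fact (d - card A) * f (A \<union> S) * (\<Prod>i\<in>A. w i) * w 0 ^ (d - card A)"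
  have "{..<n + 1} = insert 0 {1..n}" by auto
  then have "(\<Sum>j<n + 1. w j * partial_op j (potts n f w) S d)
      = w 0 * potts n f w S (d - 1) + (\<Sum>j\<in>{1..n}. w j * partial_op j (potts n f w) S d)"
    by (simp add: partial_op_def[of 0])
  also have "(\<Sum>j\<in>{1..n}. w j * partial_op j (potts n f w) S d) = (\<Sum>j\<in>?V. w j * potts n f w (insert j S) (d - 1))"
    by (intro sum.mono_neutral_cong_right) (auto simp: partial_op_def)
  also have "\<dots> = (\<Sum>j\<in>?V. \<Sum>A\<in>?I. if j \<in> A then ?t A else 0)"
  proof (intro sum.cong refl)
    fix j assume j: "j \<in> ?V"
    have "w j * potts n f w (insert j S) (d - 1) = (\<Sum>A\<in>{A \<in> ?I. j \<in> A}. ?t A)"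
      unfolding potts_insert[OF j d] sum_distrib_left
    proof (intro sum.cong)
      fix A assume "A \<in> {A \<in> ?I. j \<in> A}"
      then have "finite A" "j \<in> A" using finite_subset[of A "{1..n}"] by auto
      then have "(\<Prod>i\<in>A. w i) = w j * (\<Prod>i\<in>A - {j}. w i)" by (rule prod.remove)
      then show "w j * (fact (card ?V - card A) / fact (d - card A) * f (A \<union> S) * (\<Prod>i\<in>A - {j}. w i) * w 0 ^ (d - card A)) = ?t A"
        by simp
    qed auto
    also have "\<dots> = (\<Sum>A\<in>?I. if j \<in> A then ?t A else 0)"
      by (rule sum.inter_filter) simp
    finally show "w j * potts n f w (insert j S) (d - 1) = (\<Sum>A\<in>?I. if j \<in> A then ?t A else 0)" .
  qed
  also have "\<dots> = (\<Sum>A\<in>?I. \<Sum>j\<in>?V. if j \<in> A then ?t A else 0)" by (rule sum.swap)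
  also have "\<dots> = (\<Sum>A\<in>?I. real (card A) * ?t A)"
  proof (intro sum.cong refl)
    fix A assume "A \<in> ?I"
    then have "{j \<in> ?V. j \<in> A} = A" by auto
    then show "(\<Sum>j\<in>?V. if j \<in> A then ?t A else 0) = real (card A) * ?t A"
      by (simp add: sum.inter_filter[symmetric])
  qed
  also have "w 0 * potts n f w S (d - 1) = (\<Sum>A\<in>?I. real (d - card A) * ?t A)"
    unfolding potts_pred[OF d] sum_distrib_left
  proof (intro sum.cong refl)
    fix A
    show "w 0 * (fact (card ?V - card A) / fact (d - card A) * f (A \<union> S) * (\<Prod>i\<in>A. w i) * (real (d - card A) * w 0 ^ (d - card A - 1))) = real (d - card A) * ?t A"
      by (cases "d - card A") auto
  qed
  also have "(\<Sum>A\<in>?I. real (d - card A) * ?t A) + (\<Sum>A\<in>?I. real (card A) * ?t A) = (\<Sum>A\<in>?I. real d * ?t A)"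
    unfolding sum.distrib[symmetric] distrib_right[symmetric] of_nat_add[symmetric] by (intro sum.cong refl) simp
  finally show ?thesis unfolding potts_def sum_distrib_left .
qed

text \<open>\<open>partial_op i\<close> only moves the indices or yields 0, so it passes through
  Euler's identity in degree \<open>d - 1\<close>. The identity is assumed for all \<open>S\<close>
  because \<open>i\<close> may be added to the set.\<close>

lemma partial_op_euler:
  assumes S: "S \<subseteq> {1..n}" and i: "i \<le> n" and d: "d \<ge> 1"
    and euler: "\<And>S. S \<subseteq> {1..n} \<Longrightarrow> (\<Sum>k<n + 1. w k * F k S (d - 1)) = c * G S (d - 1)"
  shows "(\<Sum>k<n + 1. w k * partial_op i (F k) S d) = c * partial_op i G S d"
  using euler[OF S] euler[of "insert i S"] S i by (simp add: partial_op_def)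

section \<open>Hessians\<close>

lemma bilin_pos:
  assumes "0 < n" and nonneg: "\<And>i j. i < n \<Longrightarrow> j < n \<Longrightarrow> 0 \<le> H i j" and "0 < H 0 0"
    and w: "\<And>i. i < n \<Longrightarrow> 0 < w i"
  shows "0 < bilin n H w w"
  unfolding bilin_def
proof (rule sum_pos2[of _ 0])
  have nn: "0 \<le> H i j * w i * w j" if "i < n" "j < n" for i j
    using that by (intro mult_nonneg_nonneg nonneg less_imp_le[OF w])
  then show "0 \<le> (\<Sum>j<n. H i j * w i * w j)" if "i \<in> {..<n}" for i
    using that by (intro sum_nonneg) auto
  show "0 < (\<Sum>j<n. H 0 j * w 0 * w j)"
    by (rule sum_pos2[of _ 0]) (use assms nn in auto)
qed (use assms in auto)

definition potts_weight :: "real \<Rightarrow> (nat set \<Rightarrow> nat) \<Rightarrow> nat set \<Rightarrow> real" where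
  "potts_weight q r A = q powi (- int (r A))"

section \<open>The Hessians in degree 2\<close>

lemma sum_outside_contracted:
  fixes g :: "nat \<Rightarrow> real"
  assumes "S \<subseteq> {1..n}" and "\<And>i. i \<in> S \<Longrightarrow> g i = 0"
  shows "(\<Sum>i<n + 1. g i) = g 0 + (\<Sum>i\<in>{1..n} - S. g i)"
proof -
  have "{..<n + 1} = insert 0 {1..n}" by auto
  then have "(\<Sum>i<n + 1. g i) = g 0 + (\<Sum>i\<in>{1..n}. g i)" by simp
  also have "(\<Sum>i\<in>{1..n}. g i) = (\<Sum>i\<in>{1..n} - S. g i)"
    using assms by (intro sum.mono_neutral_right) auto
  finally show ?thesis .
qed

text \<open>The nonzero entries of a Hessian in degree 2 have this form, so they do not depend on
  \<open>w\<close>.\<close>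

lemma potts_degree_0: "potts n f w S 0 = fact (card ({1..n} - S)) * f S"
proof -
  have "{A. A \<subseteq> {1..n} - S \<and> card A \<le> 0} = {{}}"
  proof -
    have "A = {}" if "A \<subseteq> {1..n} - S" "card A \<le> 0" for A
      using that(2) finite_subset[OF that(1)] by simp
    then show ?thesis by auto
  qed
  then show ?thesis by (simp add: potts_def)
qed

text \<open>
  Eliminating \<open>y 0\<close> through \<open>orth\<close> leaves the Schur complement of the entry \<open>(0, 0)\<close>, which the
  rescaling \<open>z i = f (insert i S) * y i / f S\<close> turns into the form of \<open>parallel_form_le\<close>.
\<close>

lemma (in rank_function) potts_quadratic_schur:
  assumes S: "S \<subseteq> {1..n}" and N: "2 \<le> card ({1..n} - S)" and q: "0 < q" "q \<le> 1"
    and orth: "bilin (n + 1) (\<lambda>i j. partial_op i (partial_op j (potts n (potts_weight q r) w)) S 2) y (\<lambda>i. if i = 0 then 1 else 0) = 0"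
  shows "bilin (n + 1) (\<lambda>i j. partial_op i (partial_op j (potts n (potts_weight q r) w)) S 2) y y \<le> 0"
proof -
  define V where "V = {1..n} - S"
  define f where "f = potts_weight q r"
  define H where "H = (\<lambda>i j. partial_op i (partial_op j (potts n f w)) S 2)"
  have V: "finite V" "0 \<notin> V" by (auto simp: V_def)
  \<comment> \<open>The entries of \<open>H\<close> carry (m + 2)!, (m + 1)! or m!, according to
    whether two, one or none of the derivatives are in \<open>w 0\<close>.\<close>
  obtain m where m: "card V = Suc (Suc m)" using N by (metis V_def add_2_eq_Suc le_Suc_ex)
  have fpos: "f A > 0" for A using q by (simp add: f_def potts_weight_def)
  have c1: "card ({1..n} - insert i S) = Suc m" if "i \<in> V" for i
  proof -
    have "{1..n} - insert i S = V - {i}" by (auto simp: V_def)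
    then show ?thesis using that V m by simp
  qed
  have c2: "card ({1..n} - insert i (insert j S)) = m" if "i \<in> V" "j \<in> V" "i \<noteq> j" for i j
  proof -
    have "{1..n} - insert i (insert j S) = V - {j} - {i}" by (auto simp: V_def)
    then show ?thesis using that V m by simp
  qed
  have H00: "H 0 0 = fact (Suc (Suc m)) * f S"
    using m by (simp add: H_def partial_op_def potts_degree_0 V_def del: fact_Suc)
  have Hi0: "H i 0 = fact (Suc m) * f (insert i S)" and H0i: "H 0 i = fact (Suc m) * f (insert i S)"
    if "i \<in> V" for i
    using c1[OF that] that V by (auto simp: H_def partial_op_def potts_degree_0 V_def simp del: fact_Suc)
  have Hij: "H i j = (if i = j then 0 else fact m * f (insert i (insert j S)))" if "i \<in> V" "j \<in> V" for i j
    using c2[OF that(2,1)] that V by (auto simp: H_def partial_op_def potts_degree_0 V_def insert_commute)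
  have HS: "H i j = 0" "H j i = 0" if "i \<in> S" for i j
    using that S by (auto simp: H_def partial_op_def)
  have live: "bilin (n + 1) H x z = H 0 0 * x 0 * z 0 + (\<Sum>j\<in>V. H 0 j * x 0 * z j)
      + (\<Sum>i\<in>V. H i 0 * x i * z 0) + (\<Sum>i\<in>V. \<Sum>j\<in>V. H i j * x i * z j)" for x z
  proof -
    have inner: "(\<Sum>j<n + 1. H i j * x i * z j) = H i 0 * x i * z 0 + (\<Sum>j\<in>V. H i j * x i * z j)" for i
      unfolding V_def by (rule sum_outside_contracted[OF S]) (simp add: HS)
    have "bilin (n + 1) H x z = (\<Sum>j<n + 1. H 0 j * x 0 * z j) + (\<Sum>i\<in>V. \<Sum>j<n + 1. H i j * x i * z j)"
      unfolding V_def bilin_def by (rule sum_outside_contracted[OF S]) (simp add: HS)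
    then show ?thesis unfolding inner by (simp add: sum.distrib)
  qed
  define z where "z = (\<lambda>i. f (insert i S) * y i / f S)"
  define Z where "Z = (\<Sum>i\<in>V. z i)"
  have fy: "f (insert i S) * y i = f S * z i" for i using fpos[of S] by (simp add: z_def)
  have lin: "(\<Sum>i\<in>V. H i 0 * y i * c) = fact (Suc m) * f S * Z * c" for c
  proof -
    have "(\<Sum>i\<in>V. H i 0 * y i * c) = (\<Sum>i\<in>V. fact (Suc m) * f S * c * z i)"
    proof (intro sum.cong refl)
      fix i assume "i \<in> V"
      then have "H i 0 * y i * c = fact (Suc m) * (f (insert i S) * y i) * c" by (simp only: Hi0 mult.assoc)
      then show "H i 0 * y i * c = fact (Suc m) * f S * c * z i" unfolding fy by (simp only: mult_ac)
    qed
    also have "\<dots> = fact (Suc m) * f S * c * Z"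
      unfolding Z_def by (rule sum_distrib_left[symmetric])
    finally show ?thesis by (simp only: mult_ac)
  qed
  have lin': "(\<Sum>j\<in>V. H 0 j * y 0 * y j) = fact (Suc m) * f S * Z * y 0"
    unfolding lin[symmetric] by (intro sum.cong refl) (simp only: H0i Hi0 mult_ac)
  have quad: "(\<Sum>i\<in>V. \<Sum>j\<in>V. H i j * y i * y j)
      = fact m * f S * (\<Sum>i\<in>V. \<Sum>j\<in>V. (if i = j then 0 else if parallel S i j then q else 1) * z i * z j)"
    unfolding sum_distrib_left
  proof (intro sum.cong refl)
    fix i j assume ij: "i \<in> V" "j \<in> V"
    show "H i j * y i * y j = fact m * f S * ((if i = j then 0 else if parallel S i j then q else 1) * z i * z j)"
    proof (cases "i = j")
      case False
      let ?e = "if parallel S i j then 1 else 0 :: nat"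
      \<comment> \<open>\<open>rank_insert_insert\<close> turns the rank defect of a parallel pair
        into a factor \<open>q\<close>.\<close>
      have "f S * f (insert i (insert j S)) = inverse (q ^ (r S + r (insert i (insert j S))))"
        by (simp add: f_def potts_weight_def power_int_minus power_add)
      also have "\<dots> = q ^ ?e * inverse (q ^ (r S + r (insert i (insert j S)) + ?e))"
        using q by (simp add: power_add)
      also have "\<dots> = q ^ ?e * (f (insert i S) * f (insert j S))"
        unfolding rank_insert_insert[OF False, symmetric]
        by (simp add: f_def potts_weight_def power_int_minus power_add)
      finally have ff: "f (insert i (insert j S)) = q ^ ?e * (f (insert i S) * f (insert j S)) / f S"
        using fpos[of S] by (simp add: field_simps)
      have "H i j * y i * y j = fact m * (q ^ ?e * ((f (insert i S) * y i) * (f (insert j S) * y j)) / f S)"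
        unfolding Hij[OF ij] ff using False by simp
      also have "\<dots> = fact m * f S * (q ^ ?e * z i * z j)"
        unfolding fy using fpos[of S] by simp
      finally show ?thesis using False by simp
    qed (simp add: Hij ij)
  qed
  \<comment> \<open>Pairing with e_0 leaves one linear equation, which expresses \<open>Z\<close>
    through \<open>y 0\<close>.\<close>
  have "bilin (n + 1) H y (\<lambda>i. if i = 0 then 1 else 0) = H 0 0 * y 0 + (\<Sum>i\<in>V. H i 0 * y i * 1)"
  proof -
    have "(\<Sum>j\<in>V. H i j * x * (if j = 0 then 1 else 0)) = 0" for i x
      using V by (intro sum.neutral) auto
    then show ?thesis unfolding live by simp
  qed
  then have "fact (Suc (Suc m)) * f S * y 0 + fact (Suc m) * f S * Z = 0"
    using orth unfolding H00 lin by (simp add: H_def f_def)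
  then have "fact (Suc m) * f S * ((real m + 2) * y 0 + Z) = 0"
    by (simp add: algebra_simps)
  then have Z: "Z = - ((real m + 2) * y 0)" using fpos[of S] by (simp add: add_eq_0_iff)
  let ?B = "\<Sum>i\<in>V. \<Sum>j\<in>V. (if i = j then 0 else if parallel S i j then q else 1) * z i * z j"
  have "(real m + 2) * ?B \<le> (real m + 1) * Z\<^sup>2"
    using parallel_form_le[OF V(1) q, of S z] m by (simp add: Z_def add.commute)
  also have "\<dots> = (real m + 2) * ((real m + 1) * (real m + 2) * (y 0)\<^sup>2)"
    unfolding Z by (simp add: power2_eq_square)
  finally have B: "?B \<le> (real m + 1) * (real m + 2) * (y 0)\<^sup>2" by simp
  have "bilin (n + 1) H y y = fact m * f S * (?B - (real m + 1) * (real m + 2) * (y 0)\<^sup>2)"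
    unfolding live H00 lin lin' quad Z by (simp add: power2_eq_square algebra_simps)
  also have "\<dots> \<le> 0" using B fpos[of S] by (intro mult_nonneg_nonpos) auto
  finally show ?thesis by (simp add: H_def f_def)
qed

text \<open>The bound \<open>d \<le> card ({1..n} - S)\<close> survives each derivative: one in
  \<open>w 0\<close> lowers \<open>d\<close> alone, one in another \<open>w i\<close> lowers both
  sides. At \<open>d = 2\<close> it supplies the two elements that the base case needs.\<close>

lemma (in rank_function) potts_hessian_negative_on_complement:
  assumes w: "\<And>i. i \<le> n \<Longrightarrow> 0 < w i" and q: "0 < q" "q \<le> 1"
  shows "2 \<le> d \<Longrightarrow> S \<subseteq> {1..n} \<Longrightarrow> d \<le> card ({1..n} - S) \<Longrightarrow>
    bilin (n + 1) (\<lambda>i j. partial_op i (partial_op j (potts n (potts_weight q r) w)) S d) x w = 0 \<Longrightarrow>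
    bilin (n + 1) (\<lambda>i j. partial_op i (partial_op j (potts n (potts_weight q r) w)) S d) x x \<le> 0"
proof (induction d arbitrary: S x rule: less_induct)
  case (less d)
  define G where "G = potts n (potts_weight q r) w"
  have Gpos: "G S d > 0" for S d
    unfolding G_def using q by (intro potts_pos w) (auto simp: potts_weight_def)
  let ?H = "\<lambda>S d i j. partial_op i (partial_op j G) S d"
  have sym: "?H S d i j = ?H S d j i" for S d i j by (simp add: partial_op_commute)
  have nonneg: "?H S d i j \<ge> 0" for S d i j
    using less_imp_le[OF Gpos] by (simp add: partial_op_def)
  have row: "(\<Sum>j<n + 1. ?H S d i j * w j) = real (d - 1) * partial_op i G S d"
    if "S \<subseteq> {1..n}" "i \<le> n" "2 \<le> d" for S i d
  proof -
    have "(\<Sum>k<n + 1. w k * partial_op i (partial_op k G) S d) = real (d - 1) * partial_op i G S d"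
      by (rule partial_op_euler[OF that(1,2)]) (use that potts_euler[of _ n "d - 1" w] in \<open>auto simp: G_def\<close>)
    then show ?thesis by (simp add: mult.commute)
  qed
  have ww_pos: "bilin (n + 1) (?H S d) w w > 0" if "S \<subseteq> {1..n}" "2 \<le> d" for S d
  proof (rule bilin_pos)
    show "?H S d 0 0 > 0" using Gpos by (simp add: partial_op_def)
  qed (use nonneg w in auto)
  note d2 = less.prems(1) and S = less.prems(2) and dN = less.prems(3)
  show ?case
  proof (cases "d = 2")
    case True
    have N: "2 \<le> card ({1..n} - S)" using dN True by simp
    show ?thesis
    proof (rule ccontr)
      \<comment> \<open>In degree 2 the form is known to be at most 0 on the complement of e_0
        instead of \<open>w\<close>. This still excludes orthogonal positive pairs, such as
        \<open>x\<close> and \<open>w\<close> would be.\<close>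
      assume "\<not> ?thesis"
      then have xx: "bilin (n + 1) (?H S d) x x > 0" by (simp add: G_def)
      have orth: "bilin (n + 1) (?H S d) x w = 0" using less.prems(4) by (simp add: G_def)
      have "bilin (n + 1) (?H S d) y y \<le> 0" if "bilin (n + 1) (?H S d) y (\<lambda>i. if i = 0 then 1 else 0) = 0" for y
        using potts_quadratic_schur[OF S N q, of w y] that unfolding True G_def by blast
      from no_orthogonal_positive_pair[OF sym this orth xx ww_pos[OF S d2]] show False .
    qed
  next
    case False
    with d2 have d3: "d \<ge> 3" by simp
    let ?Q = "\<lambda>i j k. partial_op i (partial_op j (partial_op k G)) S d"
    have Q0: "?Q 0 = ?H S (d - 1)" by (intro ext) (simp add: partial_op_def[of 0])
    have Qi: "?Q i = ?H (insert i S) (d - 1)" if "i \<noteq> 0" "i \<notin> S" for i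
      using that by (intro ext) (simp add: partial_op_def[of i])
    \<comment> \<open>For \<open>i\<close> outside \<open>S\<close>, \<open>?Q i\<close> is again a
      Hessian of the family, of degree \<open>d - 1\<close>, so the induction hypothesis
      applies.\<close>
    have Qcs: "bilin (n + 1) (?Q i) y y * bilin (n + 1) (?Q i) w w \<le> (bilin (n + 1) (?Q i) y w)\<^sup>2"
      if i: "i \<le> n" "i \<notin> S" for i y
    proof -
      define S' where "S' = (if i = 0 then S else insert i S)"
      have Q: "?Q i = ?H S' (d - 1)" using Q0 Qi i by (simp add: S'_def)
      have S': "S' \<subseteq> {1..n}" using S i by (auto simp: S'_def)
      have N': "d - 1 \<le> card ({1..n} - S')"
      proof (cases "i = 0")
        case False
        then have "card ({1..n} - insert i S) = card ({1..n} - S) - 1"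
          using i by (metis Diff_insert card_Diff_singleton Diff_iff atLeastAtMost_iff One_nat_def Suc_leI bot_nat_0.not_eq_extremum)
        then show ?thesis using False dN by (simp add: S'_def)
      qed (use dN in \<open>simp add: S'_def\<close>)
      show ?thesis unfolding Q
      proof (rule negative_on_complement_imp_cauchy_schwarz[OF sym])
        show "bilin (n + 1) (?H S' (d - 1)) y y \<le> 0" if "bilin (n + 1) (?H S' (d - 1)) y w = 0" for y
          using less.IH[of "d - 1" S' y] that d3 S' N' by (simp add: G_def)
        show "bilin (n + 1) (?H S' (d - 1)) w w > 0" using ww_pos[OF S'] d3 by simp
      qed
    qed
    \<comment> \<open>Euler's identity for the second derivatives, which are homogeneous of degree
      \<open>d - 2\<close>.\<close>
    have Qw: "bilin (n + 1) (?Q i) y w = real (d - 2) * (\<Sum>j<n + 1. ?H S d i j * y j)" if i: "i \<le> n" for i y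
    proof -
      have "(\<Sum>k<n + 1. ?Q i j k * w k) = real (d - 2) * ?H S d i j" if j: "j \<le> n" for j
      proof -
        have "(\<Sum>k<n + 1. w k * partial_op i (partial_op j (partial_op k G)) S d) = real (d - 2) * partial_op i (partial_op j G) S d"
        proof (rule partial_op_euler[OF S i])
          show "(\<Sum>k<n + 1. w k * partial_op j (partial_op k G) T (d - 1)) = real (d - 2) * partial_op j G T (d - 1)" if "T \<subseteq> {1..n}" for T
            using row[OF that j, of "d - 1"] d3 by (simp add: mult.commute)
        qed (use d3 in simp)
        then show ?thesis by (simp add: mult.commute)
      qed
      then have "bilin (n + 1) (?Q i) y w = (\<Sum>j<n + 1. y j * (real (d - 2) * ?H S d i j))"
        unfolding bilin_eq_sum_left by (intro sum.cong refl) simp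
      then show ?thesis by (simp only: sum_distrib_left mult_ac)
    qed
    show ?thesis
    proof (rule negative_on_complement_of_positive_vector[where a = w])
      fix y
      let ?r = "\<lambda>i. \<Sum>j<n + 1. ?H S d i j * y j"
      let ?s = "\<lambda>i. \<Sum>j<n + 1. ?H S d i j * w j"
      \<comment> \<open>For \<open>i\<close> in \<open>S\<close> both sides are 0, the right one by
        division by 0. Otherwise \<open>?Q i\<close> has the value
        \<open>real (d - 2) * ?s i > 0\<close> at \<open>w\<close>, by which the inequality
        \<open>Qcs\<close> is divided.\<close>
      have summand: "w i * bilin (n + 1) (?Q i) y y \<le> real (d - 2) * (w i * (?r i)\<^sup>2 / ?s i)" if i: "i \<le> n" for i
      proof (cases "i \<in> S")
        case True
        then have "?Q i = (\<lambda>_ _. 0)" "?s i = 0" using S by (auto simp: partial_op_def[of i])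
        then show ?thesis by (simp add: bilin_def)
      next
        case False
        have s: "?s i > 0" using row[OF S i d2] d2 Gpos False by (simp add: partial_op_def)
        have e: "real (d - 2) > 0" using d3 by simp
        have "bilin (n + 1) (?Q i) y y * (real (d - 2) * ?s i) \<le> (real (d - 2) * ?r i)\<^sup>2"
          using Qcs[OF i False, of y] unfolding Qw[OF i] .
        also have "\<dots> = (real (d - 2) * (?r i)\<^sup>2) * real (d - 2)" by (simp add: power2_eq_square)
        finally have "bilin (n + 1) (?Q i) y y * ?s i \<le> real (d - 2) * (?r i)\<^sup>2"
          using e by (simp add: mult_ac)
        then have "bilin (n + 1) (?Q i) y y \<le> real (d - 2) * (?r i)\<^sup>2 / ?s i"
          using s by (simp add: pos_le_divide_eq)
        then have "w i * bilin (n + 1) (?Q i) y y \<le> w i * (real (d - 2) * (?r i)\<^sup>2 / ?s i)"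
          using w[OF i] by (intro mult_left_mono) auto
        then show ?thesis by (simp add: mult_ac)
      qed
      \<comment> \<open>Euler's identity again; commuting the three derivatives moves the summation
        index to the innermost place.\<close>
      have "real (d - 2) * bilin (n + 1) (?H S d) y y = (\<Sum>i<n + 1. w i * bilin (n + 1) (?Q i) y y)"
      proof -
        have "(\<Sum>i<n + 1. w i * ?Q i j k) = real (d - 2) * ?H S d j k" if j: "j \<le> n" and k: "k \<le> n" for j k
        proof -
          have "?Q i j k = partial_op j (partial_op k (partial_op i G)) S d" for i by (metis partial_op_commute)
          moreover have "(\<Sum>i<n + 1. w i * partial_op j (partial_op k (partial_op i G)) S d) = real (d - 2) * ?H S d j k"
          proof (rule partial_op_euler[OF S j])
            show "(\<Sum>i<n + 1. w i * partial_op k (partial_op i G) T (d - 1)) = real (d - 2) * partial_op k G T (d - 1)" if "T \<subseteq> {1..n}" for T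
              using row[OF that k, of "d - 1"] d3 by (simp add: mult.commute)
          qed (use d3 in simp)
          ultimately show ?thesis by simp
        qed
        then have "real (d - 2) * bilin (n + 1) (?H S d) y y
            = (\<Sum>j<n + 1. \<Sum>k<n + 1. (\<Sum>i<n + 1. w i * ?Q i j k) * y j * y k)"
          unfolding bilin_def sum_distrib_left by (intro sum.cong refl) (simp add: mult.assoc)
        also have "\<dots> = (\<Sum>j<n + 1. \<Sum>k<n + 1. \<Sum>i<n + 1. w i * (?Q i j k * y j * y k))"
          by (intro sum.cong refl) (simp only: sum_distrib_right mult.assoc)
        also have "\<dots> = (\<Sum>j<n + 1. \<Sum>i<n + 1. \<Sum>k<n + 1. w i * (?Q i j k * y j * y k))"
          by (intro sum.cong refl sum.swap)
        also have "\<dots> = (\<Sum>i<n + 1. \<Sum>j<n + 1. \<Sum>k<n + 1. w i * (?Q i j k * y j * y k))"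
          by (rule sum.swap)
        finally show ?thesis unfolding bilin_def sum_distrib_left .
      qed
      also have "\<dots> \<le> real (d - 2) * (\<Sum>i<n + 1. w i * (?r i)\<^sup>2 / ?s i)"
        unfolding sum_distrib_left by (intro sum_mono summand) simp
      finally show "bilin (n + 1) (\<lambda>i j. partial_op i (partial_op j (potts n (potts_weight q r) w)) S d) y y
          \<le> (\<Sum>i<n + 1. w i * (\<Sum>j<n + 1. partial_op i (partial_op j (potts n (potts_weight q r) w)) S d * y j)\<^sup>2
            / (\<Sum>j<n + 1. partial_op i (partial_op j (potts n (potts_weight q r) w)) S d * w j))"
        using d3 unfolding G_def by simp
    next
      \<comment> \<open>Index 0 is the hub: a nonzero entry in row \<open>i\<close> means that
        \<open>i\<close> is 0 or outside \<open>S\<close>, and then \<open>?H S d i 0\<close> is a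
        value of \<open>G\<close>, hence positive.\<close>
      fix i j assume "partial_op i (partial_op j (potts n (potts_weight q r) w)) S d > 0"
      then have "?H S d i j > 0" by (simp add: G_def)
      then have "i = 0 \<or> i \<notin> S" by (auto simp: partial_op_def split: if_splits)
      then have "?H S d i 0 > 0" using Gpos by (auto simp: partial_op_def)
      then show "partial_op i (partial_op 0 (potts n (potts_weight q r) w)) S d > 0" by (simp add: G_def)
    qed (use sym nonneg w less.prems(4) in \<open>auto simp: G_def\<close>)
  qed
qed

theorem theorem1:
  fixes n :: nat and indep :: "nat set \<Rightarrow> bool" and w :: "nat \<Rightarrow> real" and q :: real
  assumes "n \<ge> 2"
    and "matroid {1..n} indep"
    and "\<And>i. i \<le> n \<Longrightarrow> 0 < w i"
    and "0 < q" and "q \<le> 1"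
  shows "num_pos_eigenvalues (hessian (n + 1) (tutte_Z n indep q) w) = 1"
proof -
  interpret matroid "{1..n}" indep by fact
  let ?r = "matroid_rank indep"
  interpret rank_function ?r
    by unfold_locales (rule rank_mono rank_insert_le rank_insert_submodular; assumption?)+
  let ?G = "potts n (potts_weight q ?r) w"
  let ?H = "\<lambda>i j. partial_op i (partial_op j ?G) {} n"
  have "tutte_Z n indep q = (\<lambda>w. potts n (potts_weight q ?r) w {} n)"
    by (intro ext) (simp add: tutte_Z_eq_potts potts_weight_def[abs_def])
  then have "hessian (n + 1) (tutte_Z n indep q) w = mat (n + 1) (n + 1) (\<lambda>(i, j). ?H i j)"
    using hessian_potts[OF assms(1)] by simp
  moreover have "num_pos_eigenvalues (mat (n + 1) (n + 1) (\<lambda>(i, j). ?H i j)) = 1"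
  proof (rule num_pos_eigenvalues_eq_1[where a = w])
    show "?H i j = ?H j i" for i j by (simp add: partial_op_commute)
    show "bilin (n + 1) ?H x x \<le> 0" if "bilin (n + 1) ?H x w = 0" for x
      \<comment> \<open>The member \<open>S = {}\<close>, \<open>d = n\<close> of the family meets
        the degree bound with equality.\<close>
      using potts_hessian_negative_on_complement[of n w q n "{}" x] assms that by simp
    have pos: "?G S d > 0" for S d
      using assms by (intro potts_pos) (auto simp: potts_weight_def)
    have nonneg: "?H i j \<ge> 0" for i j using less_imp_le[OF pos] by (simp add: partial_op_def)
    show "bilin (n + 1) ?H w w > 0"
    proof (rule bilin_pos)
      show "?H 0 0 > 0" using pos by (simp add: partial_op_def)
    qed (use nonneg assms(3) in auto)
  qed
  ultimately show ?thesis by simp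
qed

end
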